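(* Let $r>0$ and $h>0$. There exists $\delta=\delta(r,h)>0$ such that $E_{r,h}[\mathbf{n}]>E_{r,h}[\mathbf{e}_3]$ for all $\mathbf{n}\in\mathcal{M}'$ with $0<\|\mathbf{n}-\mathbf{e}_3\|_{L^4(\mathbb{R}^2)}\le\delta$.
   Context: Maps $\mathbf{n}=(n_1,n_2,n_3):\mathbb{R}^2\to\mathbb{S}^2\subset\mathbb{R}^3$; $\mathbf{e}_3=(0,0,1)$. $D[\mathbf{n}]=\frac12\int|\nabla\mathbf{n}|^2dx$, $H[\mathbf{n}]=\int(\mathbf{n}-\mathbf{e}_3)\cdot(\nabla\times\mathbf{n})dx$ with $\nabla\times\mathbf{n}=(\partial_2n_3,-\partial_1n_3,\partial_1n_2-\partial_2n_1)$, $V[\mathbf{n}]=\frac18\int|\mathbf{n}-\mathbf{e}_3|^4dx$, $Z[\mathbf{n}]=\int(1-n_3)dx=\frac12\int|\mathbf{n}-\mathbf{e}_3|^2dx$ (integrals over $\mathbb{R}^2$), $E_{r,h}=D+rH+V+hZ$. $\mathcal{M}'=\{\mathbf{n}:\mathbb{R}^2\to\mathbb{S}^2\mid D[\mathbf{n}]+Z[\mathbf{n}]<\infty\}$. *)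

theory Defs
  imports "HOL-Analysis.Analysis"
begin

definition e3 :: "real^3" where
  "e3 = axis 3 1"

definition test_fun :: "(real^2 \<Rightarrow> real) \<Rightarrow> (real^2 \<Rightarrow> real^2) \<Rightarrow> bool" where
  "test_fun phi dphi \<longleftrightarrow>
     (\<forall>x. (phi has_derivative (\<lambda>v. dphi x \<bullet> v)) (at x)) \<and>
     continuous_on UNIV dphi \<and> bounded {x. phi x \<noteq> 0}"

definition weak_partial :: "(real^2 \<Rightarrow> real) \<Rightarrow> 2 \<Rightarrow> (real^2 \<Rightarrow> real) \<Rightarrow> bool" where
  "weak_partial f i g \<longleftrightarrow>
     (\<forall>K. compact K \<longrightarrow> set_integrable lborel K f \<and> set_integrable lborel K g) \<and>
     (\<forall>phi dphi. test_fun phi dphi \<longrightarrow>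
        (\<integral>x. f x * (dphi x $ i) \<partial>lborel) = - (\<integral>x. g x * phi x \<partial>lborel))"

definition weak_gradient :: "(real^2 \<Rightarrow> real^3) \<Rightarrow> (2 \<Rightarrow> real^2 \<Rightarrow> real^3) \<Rightarrow> bool" where
  "weak_gradient n G \<longleftrightarrow> (\<forall>k i. weak_partial (\<lambda>x. n x $ k) i (\<lambda>x. G i x $ k))"

text \<open>The (a.e. unique) weak gradient.\<close>
definition wgrad :: "(real^2 \<Rightarrow> real^3) \<Rightarrow> 2 \<Rightarrow> real^2 \<Rightarrow> real^3" where
  "wgrad n = (SOME G. weak_gradient n G)"

definition Mprime :: "(real^2 \<Rightarrow> real^3) set" where
  "Mprime = {n. n \<in> borel_measurable lborel \<and> (\<forall>x. norm (n x) = 1) \<and>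
     (\<exists>G. weak_gradient n G) \<and>
     (\<integral>\<^sup>+x. ennreal (\<Sum>i\<in>UNIV. (norm (wgrad n i x))\<^sup>2) \<partial>lborel) < \<infinity> \<and>
     (\<integral>\<^sup>+x. ennreal (1 - n x $ 3) \<partial>lborel) < \<infinity>}"

definition curl :: "(real^2 \<Rightarrow> real^3) \<Rightarrow> real^2 \<Rightarrow> real^3" where
  "curl n x = vector [wgrad n 2 x $ 3, - (wgrad n 1 x $ 3), wgrad n 1 x $ 2 - wgrad n 2 x $ 1]"

definition Dir :: "(real^2 \<Rightarrow> real^3) \<Rightarrow> real" where
  "Dir n = (1/2) * (\<integral>x. (\<Sum>i\<in>UNIV. (norm (wgrad n i x))\<^sup>2) \<partial>lborel)"

definition Hel :: "(real^2 \<Rightarrow> real^3) \<Rightarrow> real" where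
  "Hel n = (\<integral>x. (n x - e3) \<bullet> curl n x \<partial>lborel)"

definition Pot :: "(real^2 \<Rightarrow> real^3) \<Rightarrow> real" where
  "Pot n = (1/8) * (\<integral>x. (norm (n x - e3)) ^ 4 \<partial>lborel)"

definition Zee :: "(real^2 \<Rightarrow> real^3) \<Rightarrow> real" where
  "Zee n = (\<integral>x. 1 - n x $ 3 \<partial>lborel)"

definition Energy :: "real \<Rightarrow> real \<Rightarrow> (real^2 \<Rightarrow> real^3) \<Rightarrow> real" where
  "Energy r h n = Dir n + r * Hel n + Pot n + h * Zee n"

definition L4_dist_e3 :: "(real^2 \<Rightarrow> real^3) \<Rightarrow> real" where
  "L4_dist_e3 n = (\<integral>x. (norm (n x - e3)) ^ 4 \<partial>lborel) powr (1/4)"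

end

theory Submission
  imports Defs
begin

text \<open>
  Put u = n - e3, so that |u|^2 = 2 (1 - n3), u3 = - |u|^2 / 2 and |u| \<le> 2. Integration by parts turns the
  helicity into 2 \<integral> u3 (d1 u2 - d2 u1), hence r |H| \<le> D / 2 + 2 r^2 Q with Q = \<integral> |u|^4. No sharp
  Sobolev inequality is needed to absorb Q: split u into its mollification v at scale 1 / (8 r) and the
  rest w. The mollification is uniformly small, |v|^2 \<le> C \<surd>Q by Jensen, while
  \<integral> |w|^2 \<le> (8 r)^(-2) \<integral> |grad u|^2. Since |u|^4 \<le> |u|^2 (2 |v|^2 + 2 |w|^2) \<le> 2 |v|^2 |u|^2 + 8 |w|^2,
  the rest is paid for by D and the mollified part by h Z as soon as Q is small.

  For weak derivatives every step is a duality argument on convolutions with test functions, so no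
  regularity of mollified functions is used.
\<close>

section \<open>Convolution with compactly supported kernels\<close>

text \<open>The obstacle is that \<open>r\<close> may be large against \<open>h\<close>. Young's
  inequality on the helicity as it stands costs a multiple of r^2 Z, more than h Z can pay. The
  integration by parts improves this to 2 r^2 Q, but the potential supplies only Q / 8, and Q \<le>
  8 Z comes with no small factor. A product bound Q \<le> C (\<integral> |u|^2) (\<integral> |grad
  u|^2) would not do either: neither factor is small when only the L^4 norm is. Hence Q has to be
  bounded by a small fraction of the gradient energy plus a small multiple of Z.

  The scale is dictated by the budget. With \<Gamma> = \<integral> |grad u|^2 = 2 D, the helicity
  spends \<Gamma> / 4, so 2 r^2 Q may spend the other \<Gamma> / 4. The rough part costs 2 r^2 * 8
  \<eta>^2 \<Gamma>, which equals \<Gamma> / 4 for \<eta> = 1 / (8 r). The kernel at this scale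
  depends on \<open>r\<close> alone, hence so does its supremum \<open>B\<close>, and the smooth
  part costs 24 r^2 sqrt (B Q) Z. The choice of \<delta> makes this at most h Z / 2. Strictness
  comes from Z \<ge> Q / 8 > 0.\<close>

definition compact_kernel :: "real \<Rightarrow> ('a::euclidean_space \<Rightarrow> real) \<Rightarrow> bool" where
  "compact_kernel R K \<longleftrightarrow> continuous_on UNIV K \<and> (\<forall>x. R < norm x \<longrightarrow> K x = 0)"

definition prob_kernel :: "real \<Rightarrow> ('a::euclidean_space \<Rightarrow> real) \<Rightarrow> bool" where
  "prob_kernel R K \<longleftrightarrow> compact_kernel R K \<and> (\<forall>x. 0 \<le> K x) \<and> (\<integral>x. K x \<partial>lborel) = 1"

definition sq_integrable :: "('a::euclidean_space \<Rightarrow> real) \<Rightarrow> bool" where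
  "sq_integrable f \<longleftrightarrow> f \<in> borel_measurable borel \<and> integrable lborel (\<lambda>x. (f x)\<^sup>2)"

definition convol :: "('a::euclidean_space \<Rightarrow> real) \<Rightarrow> ('a \<Rightarrow> real) \<Rightarrow> 'a \<Rightarrow> real" where
  "convol K f x = (\<integral>z. f z * K (x - z) \<partial>lborel)"

section \<open>Reflection and translation invariance of Lebesgue measure\<close>

lemma lborel_distr_reflect: "distr lborel borel (\<lambda>z. c - z) = (lborel :: 'a::euclidean_space measure)"
  by (subst (2) lborel_affine[of "-1" c]) (auto simp: density_1 one_ennreal_def[symmetric])

lemma lborel_distr_shift: "distr lborel borel (\<lambda>z. z + c) = (lborel :: 'a::euclidean_space measure)"
proof -
  have "(+) c = (\<lambda>z. z + c)" by (auto simp: add.commute)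
  then show ?thesis using lborel_distr_plus[of c] by simp
qed

lemma
  fixes f :: "'a::euclidean_space \<Rightarrow> real"
  assumes [measurable]: "f \<in> borel_measurable borel"
  shows integral_reflect: "(\<integral>z. f (c - z) \<partial>lborel) = (\<integral>z. f z \<partial>lborel)"
    and integrable_reflect: "integrable lborel (\<lambda>z. f (c - z)) \<longleftrightarrow> integrable lborel f"
    and integral_shift: "(\<integral>z. f (z + c) \<partial>lborel) = (\<integral>z. f z \<partial>lborel)"
    and integrable_shift: "integrable lborel (\<lambda>z. f (z + c)) \<longleftrightarrow> integrable lborel f"
proof -
  have "(\<integral>z. f z \<partial>(distr lborel borel (\<lambda>z. c - z))) = (\<integral>z. f (c - z) \<partial>lborel)"
    by (rule integral_distr) auto
  then show "(\<integral>z. f (c - z) \<partial>lborel) = (\<integral>z. f z \<partial>lborel)"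
    by (simp add: lborel_distr_reflect)
  have "integrable (distr lborel borel (\<lambda>z. c - z)) f \<longleftrightarrow> integrable lborel (\<lambda>z. f (c - z))"
    by (rule integrable_distr_eq) auto
  then show "integrable lborel (\<lambda>z. f (c - z)) \<longleftrightarrow> integrable lborel f"
    by (simp add: lborel_distr_reflect)
  have "(\<integral>z. f z \<partial>(distr lborel borel (\<lambda>z. z + c))) = (\<integral>z. f (z + c) \<partial>lborel)"
    by (rule integral_distr) auto
  then show "(\<integral>z. f (z + c) \<partial>lborel) = (\<integral>z. f z \<partial>lborel)"
    by (simp add: lborel_distr_shift)
  have "integrable (distr lborel borel (\<lambda>z. z + c)) f \<longleftrightarrow> integrable lborel (\<lambda>z. f (z + c))"
    by (rule integrable_distr_eq) auto
  then show "integrable lborel (\<lambda>z. f (z + c)) \<longleftrightarrow> integrable lborel f"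
    by (simp add: lborel_distr_shift)
qed

section \<open>Stability properties of compactly supported continuous kernels\<close>

lemma compact_kernel_measurable:
  "compact_kernel R K \<Longrightarrow> K \<in> borel_measurable borel"
  by (simp add: compact_kernel_def borel_measurable_continuous_onI)

lemma compact_kernel_bounded:
  assumes "compact_kernel R K"
  obtains B where "B > 0" "\<And>x. \<bar>K x\<bar> \<le> B"
proof -
  have "compact (K ` cball 0 R)"
    using assms by (intro compact_continuous_image compact_cball)
      (auto simp: compact_kernel_def intro: continuous_on_subset)
  then obtain B where B: "B > 0" "\<And>y. y \<in> K ` cball 0 R \<Longrightarrow> norm y \<le> B"
    by (meson bounded_pos compact_imp_bounded)
  have "\<bar>K x\<bar> \<le> B" for x
    using B assms by (cases "norm x \<le> R") (auto simp: compact_kernel_def not_le)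
  with B(1) that show thesis by blast
qed

lemma compact_kernel_integrable:
  assumes "compact_kernel R K"
  shows "integrable lborel K"
proof -
  have "integrable lborel (\<lambda>x. indicator (cball 0 R) x *\<^sub>R K x)"
    using assms by (intro borel_integrable_compact compact_cball)
      (auto simp: compact_kernel_def intro: continuous_on_subset)
  also have "(\<lambda>x. indicator (cball 0 R) x *\<^sub>R K x) = K"
    using assms by (auto simp: compact_kernel_def indicator_def fun_eq_iff)
  finally show ?thesis .
qed

lemma compact_kernel_uminus: "compact_kernel R K \<Longrightarrow> compact_kernel R (\<lambda>x. K (- x))"
  by (auto simp: compact_kernel_def intro!: continuous_intros elim: continuous_on_compose2)

lemma compact_kernel_translate:
  fixes K :: "'a::euclidean_space \<Rightarrow> real"
  shows "compact_kernel R K \<Longrightarrow> compact_kernel (R + norm c) (\<lambda>x. K (c - x))"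
  unfolding compact_kernel_def
proof (intro conjI allI impI; elim conjE)
  fix x :: 'a assume "R + norm c < norm x" and K: "\<forall>x. R < norm x \<longrightarrow> K x = 0"
  then have "R < norm (c - x)"
    using norm_triangle_ineq2[of x c] by (simp add: norm_minus_commute)
  then show "K (c - x) = 0" using K by blast
next
  assume "continuous_on UNIV K"
  then show "continuous_on UNIV (\<lambda>x. K (c - x))"
    by (rule continuous_on_compose2) (auto intro!: continuous_intros)
qed

lemma compact_kernel_square: "compact_kernel R K \<Longrightarrow> compact_kernel R (\<lambda>x. (K x)\<^sup>2)"
  by (auto simp: compact_kernel_def intro!: continuous_intros)

lemma compact_kernel_sq_integrable: "compact_kernel R K \<Longrightarrow> sq_integrable K"
  unfolding sq_integrable_def
  using compact_kernel_integrable[OF compact_kernel_square] compact_kernel_measurable by blast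

lemma integrable_mult_compact_kernel:
  assumes K: "compact_kernel R K" and f: "integrable lborel f"
  shows "integrable lborel (\<lambda>z. f z * K z)"
proof -
  obtain B where B: "B > 0" "\<And>x. \<bar>K x\<bar> \<le> B"
    using compact_kernel_bounded[OF K] by blast
  note [measurable] = compact_kernel_measurable[OF K] borel_measurable_integrable[OF f]
  show ?thesis
    by (rule Bochner_Integration.integrable_bound[where f = "\<lambda>z. B * f z"])
      (use f B in \<open>auto simp: abs_mult mult.commute[of B] intro!: mult_left_mono\<close>)
qed

section \<open>Calculus of square-integrable functions\<close>

lemma sq_integrable_mult:
  assumes "sq_integrable f" "sq_integrable g"
  shows "integrable lborel (\<lambda>x. f x * g x)"
proof -
  note [measurable] = assms[unfolded sq_integrable_def, THEN conjunct1]
  have b: "\<bar>f x * g x\<bar> \<le> (f x)\<^sup>2 + (g x)\<^sup>2" for x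
  proof -
    have "2 * (\<bar>f x\<bar> * \<bar>g x\<bar>) \<le> (f x)\<^sup>2 + (g x)\<^sup>2"
      using sum_squares_bound[of "\<bar>f x\<bar>" "\<bar>g x\<bar>"] by simp
    moreover have "0 \<le> \<bar>f x\<bar> * \<bar>g x\<bar>" by simp
    ultimately show ?thesis unfolding abs_mult by linarith
  qed
  show ?thesis
    by (rule Bochner_Integration.integrable_bound[where f = "\<lambda>x. (f x)\<^sup>2 + (g x)\<^sup>2"])
      (use assms b in \<open>auto simp: sq_integrable_def\<close>)
qed

lemma sq_integrable_add:
  assumes "sq_integrable f" "sq_integrable g"
  shows "sq_integrable (\<lambda>x. f x + g x)"
proof -
  have "(\<lambda>x. (f x + g x)\<^sup>2) = (\<lambda>x. (f x)\<^sup>2 + (g x)\<^sup>2 + 2 * (f x * g x))"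
    by (auto simp: power2_sum)
  then show ?thesis
    using assms sq_integrable_mult[OF assms] by (auto simp: sq_integrable_def)
qed

lemma sq_integrable_cmult: "sq_integrable f \<Longrightarrow> sq_integrable (\<lambda>x. c * f x)"
  by (auto simp: sq_integrable_def power_mult_distrib)

lemma sq_integrable_diff:
  assumes "sq_integrable f" "sq_integrable g"
  shows "sq_integrable (\<lambda>x. f x - g x)"
  using sq_integrable_add[OF assms(1) sq_integrable_cmult[OF assms(2), of "-1"]] by simp

lemma sq_integrable_reflect: "sq_integrable f \<Longrightarrow> sq_integrable (\<lambda>x. f (c - x))"
  by (auto simp: sq_integrable_def integrable_reflect[of "\<lambda>x. (f x)\<^sup>2"])

lemma sq_integrable_shift: "sq_integrable f \<Longrightarrow> sq_integrable (\<lambda>x. f (x + c))"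
  by (auto simp: sq_integrable_def integrable_shift[of "\<lambda>x. (f x)\<^sup>2"])

text \<open>Young's inequality with a free weight, in place of Cauchy-Schwarz: \<open>t\<close> is
  tuned later to 1 in the duality argument, to the mollification scale in the integration by parts
  and to 4 r in the helicity estimate.\<close>

lemma integral_mult_le_square:
  assumes f: "sq_integrable f" and g: "sq_integrable g" and t: "t > 0"
  shows "2 * \<bar>\<integral>x. f x * g x \<partial>lborel\<bar>
    \<le> t * (\<integral>x. (f x)\<^sup>2 \<partial>lborel) + (\<integral>x. (g x)\<^sup>2 \<partial>lborel) / t"
proof -
  have *: "2 * \<bar>f x * g x\<bar> \<le> t * (f x)\<^sup>2 + (g x)\<^sup>2 / t" for x
  proof -
    have "0 \<le> (t * \<bar>f x\<bar> - \<bar>g x\<bar>)\<^sup>2 / t" using t by simp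
    also have "\<dots> = t * (f x)\<^sup>2 + (g x)\<^sup>2 / t - 2 * \<bar>f x * g x\<bar>"
      using t by (simp add: field_simps power2_eq_square abs_mult)
    finally show ?thesis by linarith
  qed
  have fg: "integrable lborel (\<lambda>x. f x * g x)" by (rule sq_integrable_mult[OF f g])
  have "2 * \<bar>\<integral>x. f x * g x \<partial>lborel\<bar> \<le> 2 * (\<integral>x. \<bar>f x * g x\<bar> \<partial>lborel)"
    using integral_abs_bound[of lborel "\<lambda>x. f x * g x"] by simp
  also have "\<dots> = (\<integral>x. 2 * \<bar>f x * g x\<bar> \<partial>lborel)" by simp
  also have "\<dots> \<le> (\<integral>x. t * (f x)\<^sup>2 + (g x)\<^sup>2 / t \<partial>lborel)"
    using f g fg * by (intro integral_mono) (auto simp: sq_integrable_def)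
  also have "\<dots> = t * (\<integral>x. (f x)\<^sup>2 \<partial>lborel) + (\<integral>x. (g x)\<^sup>2 \<partial>lborel) / t"
    using f g by (simp add: sq_integrable_def)
  finally show ?thesis .
qed

text \<open>By translation invariance the inner integral of |K (x - z)| over x does not depend on z,
  so Tonelli reduces joint integrability to that of \<open>h\<close>.\<close>

lemma integrable_mult_translate:
  assumes h: "integrable lborel h" and K: "integrable lborel K"
  shows "integrable (lborel \<Otimes>\<^sub>M lborel) (\<lambda>(z, x). h z * K (x - z :: 'a::euclidean_space) :: real)"
proof (rule lborel_pair.Fubini_integrable)
  have [measurable]: "h \<in> borel_measurable borel" "K \<in> borel_measurable borel"
    using borel_measurable_integrable[OF h] borel_measurable_integrable[OF K] by auto
  show "(\<lambda>(z, x). h z * K (x - z)) \<in> borel_measurable (lborel \<Otimes>\<^sub>M lborel)"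
    by measurable
  have KK: "integrable lborel (\<lambda>x. \<bar>K x\<bar>)" using K by auto
  have *: "(\<integral>x. \<bar>K (x - z)\<bar> \<partial>lborel) = (\<integral>x. \<bar>K x\<bar> \<partial>lborel)" for z
    using integral_shift[of "\<lambda>x. \<bar>K x\<bar>" "- z"] by simp
  show "integrable lborel (\<lambda>z. \<integral>x. norm (case (z, x) of (z, x) \<Rightarrow> h z * K (x - z)) \<partial>lborel)"
    using h by (simp add: abs_mult *)
  have "integrable lborel (\<lambda>x. K (x - z))" for z
    using integrable_shift[of K "- z"] K by simp
  then show "AE z in lborel. integrable lborel (\<lambda>x. case (z, x) of (z, x) \<Rightarrow> h z * K (x - z))"
    by simp
qed

lemma
  assumes K: "integrable lborel K" and h: "integrable lborel h"
  shows integrable_convol: "integrable lborel (convol K h)"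
    and integral_convol: "(\<integral>x. convol K h x \<partial>lborel) = (\<integral>x. h x \<partial>lborel) * (\<integral>x. K x \<partial>lborel)"
proof -
  have P: "integrable (lborel \<Otimes>\<^sub>M lborel) (\<lambda>(z, x). h z * K (x - z))"
    by (rule integrable_mult_translate[OF h K])
  show "integrable lborel (convol K h)"
    using lborel_pair.integrable_snd[OF P] by (simp add: convol_def[abs_def])
  have [measurable]: "K \<in> borel_measurable borel"
    using borel_measurable_integrable[OF K] by auto
  have "(\<integral>x. convol K h x \<partial>lborel) = (\<integral>z. \<integral>x. h z * K (x - z) \<partial>lborel \<partial>lborel)"
    using lborel_pair.Fubini_integral[OF P] by (simp add: convol_def)
  also have "\<dots> = (\<integral>z. h z * (\<integral>x. K x \<partial>lborel) \<partial>lborel)"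
    using integral_shift[of K "- z" for z] by simp
  finally show "(\<integral>x. convol K h x \<partial>lborel) = (\<integral>x. h x \<partial>lborel) * (\<integral>x. K x \<partial>lborel)"
    by simp
qed

lemma convol_measurable:
  assumes [measurable]: "K \<in> borel_measurable borel" "f \<in> borel_measurable borel"
  shows "convol K f \<in> borel_measurable borel"
  unfolding convol_def by measurable

text \<open>Jensen's inequality for the square: with c the mean of \<open>f\<close> under the
  density \<open>p\<close>, the variance \<integral> (f - c)^2 p is nonnegative. The mean exists
  because |f| \<le> f^2 + 1.\<close>

lemma sq_integral_mult_prob_le:
  fixes f p :: "'a::euclidean_space \<Rightarrow> real"
  assumes p0: "\<And>z. 0 \<le> p z" and p: "integrable lborel p" "(\<integral>z. p z \<partial>lborel) = 1"
    and f: "f \<in> borel_measurable borel" and f2: "integrable lborel (\<lambda>z. (f z)\<^sup>2 * p z)"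
  shows "integrable lborel (\<lambda>z. f z * p z)"
    and "(\<integral>z. f z * p z \<partial>lborel)\<^sup>2 \<le> (\<integral>z. (f z)\<^sup>2 * p z \<partial>lborel)"
proof -
  note [measurable] = f borel_measurable_integrable[OF p(1)]
  have ab: "\<bar>f z\<bar> \<le> (f z)\<^sup>2 + 1" for z
  proof -
    have "0 \<le> (\<bar>f z\<bar> - 1)\<^sup>2" by simp
    then have "2 * \<bar>f z\<bar> \<le> (f z)\<^sup>2 + 1" unfolding power2_diff by simp
    then show ?thesis using abs_ge_zero[of "f z"] by linarith
  qed
  have b: "norm (f z * p z) \<le> norm ((f z)\<^sup>2 * p z + p z)" for z
    using mult_right_mono[OF ab p0, of z z] p0[of z] by (simp add: abs_mult algebra_simps)
  show fp: "integrable lborel (\<lambda>z. f z * p z)"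
  proof (rule Bochner_Integration.integrable_bound)
    show "integrable lborel (\<lambda>z. (f z)\<^sup>2 * p z + p z)" using f2 p by simp
  qed (use b in \<open>simp_all\<close>)
  define c where "c = (\<integral>z. f z * p z \<partial>lborel)"
  have "0 \<le> (\<integral>z. (f z - c)\<^sup>2 * p z \<partial>lborel)"
    using p0 by (intro integral_nonneg_AE) auto
  also have "(\<lambda>z. (f z - c)\<^sup>2 * p z) = (\<lambda>z. (f z)\<^sup>2 * p z - 2 * c * (f z * p z) + c\<^sup>2 * p z)"
    by (auto simp: power2_diff algebra_simps)
  also have "(\<integral>z. \<dots> z \<partial>lborel) = (\<integral>z. (f z)\<^sup>2 * p z \<partial>lborel) - c\<^sup>2"
    using f2 fp p by (simp add: c_def[symmetric] power2_eq_square)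
  finally show "(\<integral>z. f z * p z \<partial>lborel)\<^sup>2 \<le> (\<integral>z. (f z)\<^sup>2 * p z \<partial>lborel)"
    by (simp add: c_def)
qed

lemma prob_kernel_translate:
  assumes "prob_kernel R K"
  shows "\<And>z. 0 \<le> K (x - z)" "integrable lborel (\<lambda>z. K (x - z))"
    "(\<integral>z. K (x - z) \<partial>lborel) = 1"
proof -
  have K: "compact_kernel R K" using assms by (simp add: prob_kernel_def)
  show "\<And>z. 0 \<le> K (x - z)" using assms by (simp add: prob_kernel_def)
  show "integrable lborel (\<lambda>z. K (x - z))"
    using compact_kernel_integrable[OF compact_kernel_translate[OF K]] .
  show "(\<integral>z. K (x - z) \<partial>lborel) = 1"
    using integral_reflect[OF compact_kernel_measurable[OF K]] assms by (simp add: prob_kernel_def)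
qed

lemma convol_square_le:
  assumes K: "prob_kernel R K" and f: "sq_integrable f"
  shows "(convol K f x)\<^sup>2 \<le> convol K (\<lambda>z. (f z)\<^sup>2) x"
  unfolding convol_def
proof (rule sq_integral_mult_prob_le(2)[OF prob_kernel_translate[OF K]])
  show "f \<in> borel_measurable borel" using f by (simp add: sq_integrable_def)
  show "integrable lborel (\<lambda>z. (f z)\<^sup>2 * K (x - z))"
    using K f by (intro integrable_mult_compact_kernel[OF compact_kernel_translate])
      (auto simp: prob_kernel_def sq_integrable_def)
qed

text \<open>Pointwise Jensen integrated over x: Fubini and unit mass turn the right-hand side into
  \<integral> f^2. Averaging against a probability kernel is thus an L^2 contraction.\<close>

lemma
  assumes K: "prob_kernel R K" and f: "sq_integrable f"
  shows sq_integrable_convol: "sq_integrable (convol K f)"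
    and sq_integral_convol_le: "(\<integral>x. (convol K f x)\<^sup>2 \<partial>lborel) \<le> (\<integral>x. (f x)\<^sup>2 \<partial>lborel)"
proof -
  have f2: "integrable lborel (\<lambda>z. (f z)\<^sup>2)" and [measurable]: "f \<in> borel_measurable borel"
    using f by (auto simp: sq_integrable_def)
  have KI: "integrable lborel K" and K1: "(\<integral>x. K x \<partial>lborel) = 1"
    using K compact_kernel_integrable by (auto simp: prob_kernel_def)
  have [measurable]: "convol K f \<in> borel_measurable borel"
    using borel_measurable_integrable[OF KI] by (intro convol_measurable) auto
  show "sq_integrable (convol K f)"
    unfolding sq_integrable_def
  proof
    have "norm ((convol K f x)\<^sup>2) \<le> norm (convol K (\<lambda>z. (f z)\<^sup>2) x)" for x
      using convol_square_le[OF K f, of x] by simp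
    then show "integrable lborel (\<lambda>x. (convol K f x)\<^sup>2)"
      by (intro Bochner_Integration.integrable_bound[OF integrable_convol[OF KI f2]]) auto
  qed simp
  then have "(\<integral>x. (convol K f x)\<^sup>2 \<partial>lborel) \<le> (\<integral>x. convol K (\<lambda>z. (f z)\<^sup>2) x \<partial>lborel)"
    by (intro integral_mono convol_square_le[OF K f] integrable_convol[OF KI f2])
      (simp add: sq_integrable_def)
  then show "(\<integral>x. (convol K f x)\<^sup>2 \<partial>lborel) \<le> (\<integral>x. (f x)\<^sup>2 \<partial>lborel)"
    by (simp add: integral_convol[OF KI f2] K1)
qed

text \<open>The L^2 adjoint of convolution with \<open>K\<close> is convolution with the reflected
  kernel. Fubini applies because |f g K| \<le> g^2 |K| + f^2 |K|, and each summand is an integrable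
  function times a translated kernel; for f^2 the two variables change roles, which reflects the
  kernel.\<close>

lemma integral_mult_convol:
  assumes f: "sq_integrable f" and g: "sq_integrable g" and K: "compact_kernel R K"
  shows "(\<integral>x. f x * convol K g x \<partial>lborel) = (\<integral>z. g z * convol (\<lambda>w. K (- w)) f z \<partial>lborel)"
proof -
  have [measurable]: "f \<in> borel_measurable borel" "g \<in> borel_measurable borel"
      "K \<in> borel_measurable borel"
    using f g compact_kernel_measurable[OF K] by (auto simp: sq_integrable_def)
  have Ka: "integrable lborel (\<lambda>x. \<bar>K x\<bar>)"
    using compact_kernel_integrable[OF K] by simp
  have Kb: "integrable lborel (\<lambda>x. \<bar>K (- x)\<bar>)"
    using compact_kernel_integrable[OF compact_kernel_uminus[OF K]] by simp
  have P1: "integrable (lborel \<Otimes>\<^sub>M lborel) (\<lambda>(z, x). (g z)\<^sup>2 * \<bar>K (x - z)\<bar>)"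
    using integrable_mult_translate[OF _ Ka] g by (simp add: sq_integrable_def)
  have P2: "integrable (lborel \<Otimes>\<^sub>M lborel) (\<lambda>(z, x). (f x)\<^sup>2 * \<bar>K (x - z)\<bar>)"
    using lborel_pair.integrable_product_swap[OF integrable_mult_translate[OF _ Kb, of "\<lambda>x. (f x)\<^sup>2"]] f
    by (simp add: sq_integrable_def split_beta)
  have P: "integrable (lborel \<Otimes>\<^sub>M lborel) (\<lambda>(z, x). f x * g z * K (x - z))"
  proof (rule Bochner_Integration.integrable_bound[OF Bochner_Integration.integrable_add[OF P1 P2]])
    have "\<bar>f x * g z * k\<bar> \<le> (g z)\<^sup>2 * \<bar>k\<bar> + (f x)\<^sup>2 * \<bar>k\<bar>" for x z k
    proof -
      have "2 * (\<bar>f x\<bar> * \<bar>g z\<bar>) \<le> (f x)\<^sup>2 + (g z)\<^sup>2"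
        using sum_squares_bound[of "\<bar>f x\<bar>" "\<bar>g z\<bar>"] by simp
      moreover have "0 \<le> \<bar>f x\<bar> * \<bar>g z\<bar>" by simp
      ultimately have "\<bar>f x\<bar> * \<bar>g z\<bar> \<le> (g z)\<^sup>2 + (f x)\<^sup>2" by linarith
      then have "\<bar>f x\<bar> * \<bar>g z\<bar> * \<bar>k\<bar> \<le> ((g z)\<^sup>2 + (f x)\<^sup>2) * \<bar>k\<bar>" by (rule mult_right_mono) simp
      then show ?thesis by (simp add: abs_mult algebra_simps)
    qed
    then show "AE p in lborel \<Otimes>\<^sub>M lborel. norm (case p of (z, x) \<Rightarrow> f x * g z * K (x - z))
      \<le> norm ((case p of (z, x) \<Rightarrow> (g z)\<^sup>2 * \<bar>K (x - z)\<bar>) + (case p of (z, x) \<Rightarrow> (f x)\<^sup>2 * \<bar>K (x - z)\<bar>))"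
      by (auto simp: split_beta)
  qed measurable
  have "(\<integral>x. f x * convol K g x \<partial>lborel) = (\<integral>x. (\<integral>z. f x * g z * K (x - z) \<partial>lborel) \<partial>lborel)"
    by (simp add: convol_def mult.assoc)
  also have "\<dots> = (\<integral>z. (\<integral>x. f x * g z * K (x - z) \<partial>lborel) \<partial>lborel)"
    by (rule lborel_pair.Fubini_integral[OF P])
  also have "\<dots> = (\<integral>z. g z * convol (\<lambda>w. K (- w)) f z \<partial>lborel)"
    unfolding convol_def by (subst integral_mult_right_zero[symmetric]) (simp add: mult.commute mult.left_commute)
  finally show ?thesis .
qed

section \<open>Mollifiers\<close>

text \<open>Evenness makes convolution with \<open>K\<close> self-adjoint on L^2. It also makes
  \<open>dK\<close> odd, the source of the minus sign in the integration by parts.\<close>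

definition mollifier :: "real \<Rightarrow> (real^2 \<Rightarrow> real) \<Rightarrow> (real^2 \<Rightarrow> real^2) \<Rightarrow> bool" where
  "mollifier \<eta> K dK \<longleftrightarrow> test_fun K dK \<and> prob_kernel \<eta> K \<and> (\<forall>x. K (- x) = K x)"

text \<open>Squaring removes the kink of the positive part: in every sign pattern of t and t + h the
  linearization error is at most h^2. This yields a C^1 cutoff, which is all the regularity that
  \<open>test_fun\<close> asks for.\<close>

lemma has_field_derivative_max_0_square:
  "((\<lambda>t::real. (max 0 t)\<^sup>2) has_field_derivative 2 * max 0 t) (at t)"
  unfolding DERIV_def
proof (rule Lim_transform2[OF tendsto_const[of "2 * max 0 t"]], rule Lim_null_comparison)
  show "((\<lambda>h::real. \<bar>h\<bar>) \<longlongrightarrow> 0) (at 0)"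
    by (intro tendsto_eq_intros) auto
  have "\<bar>2 * max 0 t - ((max 0 (t + h))\<^sup>2 - (max 0 t)\<^sup>2) / h\<bar> \<le> \<bar>h\<bar>" if "h \<noteq> 0" for h
  proof -
    have "\<bar>2 * max 0 t * h - ((max 0 (t + h))\<^sup>2 - (max 0 t)\<^sup>2)\<bar> \<le> h\<^sup>2"
    proof -
      consider "t \<ge> 0" "t + h \<ge> 0" | "t \<ge> 0" "t + h < 0" | "t < 0" "t + h \<ge> 0" | "t < 0" "t + h < 0"
        by linarith
      then show ?thesis
      proof cases
        case 1 then show ?thesis by (simp add: max_def power2_eq_square algebra_simps)
      next
        \<comment> \<open>The positive part of t + h vanishes, so the error is 2 t h + t^2, which
          lies between - h^2 and 0.\<close>
        case 2
        have "2 * t * h + t\<^sup>2 = (t + h)\<^sup>2 - h\<^sup>2" by (simp add: power2_eq_square algebra_simps)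
        moreover have "t * (2 * h + t) \<le> 0" using 2 by (intro mult_nonneg_nonpos) auto
        moreover have "0 \<le> (t + h)\<^sup>2" by simp
        ultimately show ?thesis using 2 by (simp add: max_def power2_eq_square algebra_simps)
      next
        case 3
        then have "(t + h)\<^sup>2 \<le> h\<^sup>2" by (intro power_mono) auto
        then show ?thesis using 3 by (simp add: max_def)
      next
        case 4 then show ?thesis by (simp add: max_def)
      qed
    qed
    then have "\<bar>2 * max 0 t * h - ((max 0 (t + h))\<^sup>2 - (max 0 t)\<^sup>2)\<bar> / \<bar>h\<bar> \<le> h\<^sup>2 / \<bar>h\<bar>"
      by (rule divide_right_mono) simp
    then show ?thesis using that
      by (simp add: power2_eq_square abs_divide[symmetric] diff_divide_distrib abs_mult_self_eq[of h, symmetric]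
        del: abs_divide abs_mult_self_eq)
  qed
  then show "\<forall>\<^sub>F h in at 0. norm (2 * max 0 t - ((max 0 (t + h))\<^sup>2 - (max 0 t)\<^sup>2) / h) \<le> \<bar>h\<bar>"
    by (simp add: eventually_at_filter)
qed

lemma mollifier_exists:
  assumes \<eta>: "\<eta> > 0"
  obtains K dK where "mollifier \<eta> K dK"
proof -
  \<comment> \<open>The squared positive part of \<eta>^2 - |x|^2 is radial, C^1 and supported in
    the ball of radius \<eta>; \<open>db\<close> is its gradient by the chain rule.\<close>
  define b :: "real^2 \<Rightarrow> real" where "b x = (max 0 (\<eta>\<^sup>2 - x \<bullet> x))\<^sup>2" for x
  define db :: "real^2 \<Rightarrow> real^2" where "db x = (- 4 * max 0 (\<eta>\<^sup>2 - x \<bullet> x)) *\<^sub>R x" for x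
  have deriv: "(b has_derivative (\<lambda>v. db x \<bullet> v)) (at x)" for x
  proof -
    have "((\<lambda>x. \<eta>\<^sup>2 - x \<bullet> x) has_derivative (\<lambda>v. - 2 * (x \<bullet> v))) (at x)"
      by (auto intro!: derivative_eq_intros simp: inner_commute)
    from DERIV_compose_FDERIV[OF has_field_derivative_max_0_square this]
    show ?thesis unfolding b_def[abs_def] db_def by (simp add: mult_ac)
  qed
  have contb: "continuous_on UNIV b"
    unfolding b_def by (intro continuous_intros)
  have contdb: "continuous_on UNIV db"
    unfolding db_def by (intro continuous_intros)
  have supp: "b x = 0" if "\<eta> < norm x" for x
  proof -
    have "\<eta>\<^sup>2 < x \<bullet> x" using that \<eta> by (simp add: dot_square_norm power_strict_mono)
    then show ?thesis by (simp add: b_def)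
  qed
  have ck: "compact_kernel \<eta> b"
    using contb supp by (simp add: compact_kernel_def)
  note bI = compact_kernel_integrable[OF ck]
  define m where "m = (\<integral>x. b x \<partial>lborel)"
  define B where "B = ball (0::real^2) (\<eta> / 2)"
  \<comment> \<open>On the ball of radius \<eta> / 2 the bump is at least (\<eta>^2 / 2)^2, and that
    ball has positive measure.\<close>
  have "m > 0"
  proof -
    have "0 < (\<eta>\<^sup>2 / 2)\<^sup>2 * measure lborel B"
      using \<eta> content_ball_pos[of "\<eta> / 2" "0::real^2"] by (simp add: B_def)
    also have "\<dots> = (\<integral>x. (\<eta>\<^sup>2 / 2)\<^sup>2 * indicator B x \<partial>lborel)" by simp
    also have "\<dots> \<le> m"
      unfolding m_def
    proof (rule integral_mono[OF _ bI])
      show "integrable lborel (\<lambda>x. (\<eta>\<^sup>2 / 2)\<^sup>2 * indicator B x)"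
        unfolding B_def using emeasure_lborel_ball_finite by (intro integrable_mult_right integrable_real_indicator) auto
      fix x :: "real^2"
      show "(\<eta>\<^sup>2 / 2)\<^sup>2 * indicator B x \<le> b x"
      proof (cases "x \<in> B")
        case True
        then have "(norm x)\<^sup>2 \<le> (\<eta> / 2)\<^sup>2" using \<eta> by (intro power_mono) (auto simp: B_def)
        then have "4 * (x \<bullet> x) \<le> \<eta>\<^sup>2"
          by (simp add: dot_square_norm power_divide)
        then have "\<eta>\<^sup>2 / 2 \<le> \<eta>\<^sup>2 - x \<bullet> x"
          using inner_ge_zero[of x] by linarith
        then have "(\<eta>\<^sup>2 / 2)\<^sup>2 \<le> b x" unfolding b_def by (intro power_mono) (simp_all only: max.coboundedI2, simp)
        then show ?thesis using True by simp
      qed (simp add: b_def)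
    qed
    finally show ?thesis .
  qed
  have "mollifier \<eta> (\<lambda>x. b x / m) (\<lambda>x. db x /\<^sub>R m)"
    unfolding mollifier_def
  proof (intro conjI allI)
    show "test_fun (\<lambda>x. b x / m) (\<lambda>x. db x /\<^sub>R m)"
      unfolding test_fun_def
    proof (intro conjI allI)
      show "((\<lambda>x. b x / m) has_derivative (\<lambda>v. (db x /\<^sub>R m) \<bullet> v)) (at x)" for x
        using has_derivative_scaleR_right[OF deriv, of "inverse m" x] by (simp add: divide_inverse mult.commute)
      show "continuous_on UNIV (\<lambda>x. db x /\<^sub>R m)"
        using contdb by (intro continuous_intros)
      show "bounded {x. b x / m \<noteq> 0}"
        using supp by (intro boundedI[of _ \<eta>]) (auto simp: not_less[symmetric])
    qed
    show "prob_kernel \<eta> (\<lambda>x. b x / m)"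
      unfolding prob_kernel_def compact_kernel_def
    proof (intro conjI allI impI)
      show "continuous_on UNIV (\<lambda>x. b x / m)"
        using contb \<open>m > 0\<close> by (intro continuous_intros) auto
      show "0 \<le> b x / m" for x using \<open>m > 0\<close> by (simp add: b_def)
      show "(\<integral>x. b x / m \<partial>lborel) = 1" using \<open>m > 0\<close> by (simp flip: m_def)
    qed (simp add: supp)
    show "b (- x) / m = b x / m" for x by (simp add: b_def)
  qed
  with that show thesis by blast
qed

section \<open>Uniform approximation, density in L^2 and the duality bound\<close>

lemma compact_kernel_uniformly_continuous:
  fixes K :: "'a::euclidean_space \<Rightarrow> real"
  assumes K: "compact_kernel R K" and e: "e > 0"
  obtains d where "d > 0" "\<And>x y. dist x y \<le> d \<Longrightarrow> \<bar>K x - K y\<bar> < e"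
proof -
  have "uniformly_continuous_on (cball 0 (R + 1)) K"
    using K by (intro compact_uniformly_continuous)
      (auto simp: compact_kernel_def intro: continuous_on_subset)
  then obtain d where d: "d > 0"
    "\<And>x y. x \<in> cball 0 (R + 1) \<Longrightarrow> y \<in> cball 0 (R + 1) \<Longrightarrow> dist y x < d \<Longrightarrow> dist (K y) (K x) < e"
    using e unfolding uniformly_continuous_on_def by blast
  have "\<bar>K x - K y\<bar> < e" if "dist x y \<le> min (d / 2) 1" for x y
  proof (cases "norm x \<le> R + 1 \<and> norm y \<le> R + 1")
    case True
    then show ?thesis using d(2)[of y x] that d(1) by (auto simp: dist_real_def)
  next
    case False
    \<comment> \<open>The margin 1 in the larger ball pays off here: if one of two points at
      distance at most 1 leaves the ball of radius R + 1, both are outside radius R, where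
      \<open>K\<close> vanishes.\<close>
    have "norm x \<le> norm y + 1" "norm y \<le> norm x + 1"
      using that norm_triangle_sub[of x y] norm_triangle_sub[of y x]
      by (auto simp: dist_norm norm_minus_commute)
    with False have "R < norm x" "R < norm y" by auto
    then show ?thesis using K e by (simp add: compact_kernel_def)
  qed
  with d(1) show thesis by (intro that[of "min (d / 2) 1"]) auto
qed

text \<open>Since \<open>K\<close> has mass one, the difference is the \<open>K\<close>-average of f
  z - f x over points z within \<eta> of x.\<close>

lemma convol_uniform_approx:
  assumes K: "prob_kernel \<eta> K" and f: "compact_kernel R f"
    and d: "\<And>z. dist x z \<le> \<eta> \<Longrightarrow> \<bar>f x - f z\<bar> \<le> e"
  shows "\<bar>convol K f x - f x\<bar> \<le> e"
proof -
  note pk = prob_kernel_translate[OF K, of x]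
  have fK: "integrable lborel (\<lambda>z. f z * K (x - z))"
    using K compact_kernel_integrable[OF f]
    by (intro integrable_mult_compact_kernel[OF compact_kernel_translate]) (auto simp: prob_kernel_def)
  have "convol K f x - f x = (\<integral>z. f z * K (x - z) - f x * K (x - z) \<partial>lborel)"
    using fK pk by (simp add: convol_def)
  also have "\<bar>\<dots>\<bar> \<le> (\<integral>z. e * K (x - z) \<partial>lborel)"
  proof (rule order_trans[OF integral_abs_bound], rule integral_mono)
    show "integrable lborel (\<lambda>z. \<bar>f z * K (x - z) - f x * K (x - z)\<bar>)"
      using fK pk by simp
    show "integrable lborel (\<lambda>z. e * K (x - z))" using pk by simp
    fix z
    show "\<bar>f z * K (x - z) - f x * K (x - z)\<bar> \<le> e * K (x - z)"
    proof (cases "dist x z \<le> \<eta>")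
      case True
      have "\<bar>f z * K (x - z) - f x * K (x - z)\<bar> = \<bar>f x - f z\<bar> * K (x - z)"
        using pk(1)[of z] by (simp add: left_diff_distrib[symmetric] abs_mult abs_minus_commute)
      also have "\<dots> \<le> e * K (x - z)" using d[OF True] pk(1)[of z] by (rule mult_right_mono)
      finally show ?thesis .
    next
      case False
      then have "K (x - z) = 0" using K by (simp add: prob_kernel_def compact_kernel_def dist_norm)
      then show ?thesis by simp
    qed
  qed
  also have "\<dots> = e" using pk by simp
  finally show ?thesis .
qed

lemma convol_support:
  assumes K: "prob_kernel \<eta> K" and f: "compact_kernel R f" and x: "R + \<eta> < norm x"
  shows "convol K f x = 0"
proof -
  have "f z * K (x - z) = 0" for z
  proof (cases "norm z \<le> R")
    case True
    have "\<eta> < norm (x - z)" using x True norm_triangle_ineq2[of x z] by linarith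
    then show ?thesis using K by (simp add: prob_kernel_def compact_kernel_def)
  next
    case False
    then show ?thesis using f by (simp add: compact_kernel_def)
  qed
  then have "(\<lambda>z. f z * K (x - z)) = (\<lambda>z. 0)" by blast
  then show ?thesis by (simp add: convol_def)
qed

text \<open>Density of continuous compactly supported functions in L^2. \<open>D\<close> is first
  clipped in height by \<open>c M\<close> and cut off in space by \<open>\<theta> M\<close>; the
  clipped function is then approximated by continuous ones. Both limits are by dominated
  convergence.\<close>

lemma compact_kernel_dense:
  fixes D :: "'a::euclidean_space \<Rightarrow> real"
  assumes D: "sq_integrable D" and e: "e > 0"
  obtains R f where "compact_kernel R f" "(\<integral>x. (D x - f x)\<^sup>2 \<partial>lborel) < e"
proof -
  have [measurable]: "D \<in> borel_measurable borel" and D2: "integrable lborel (\<lambda>x. (D x)\<^sup>2)"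
    using D by (auto simp: sq_integrable_def)
  define c :: "real \<Rightarrow> real \<Rightarrow> real" where "c M t = max (- M) (min M t)" for M t
  define \<theta> :: "real \<Rightarrow> 'a \<Rightarrow> real" where "\<theta> M x = max 0 (min 1 (M + 1 - norm x))" for M x
  have \<theta>: "0 \<le> \<theta> M x" "\<theta> M x \<le> 1" for M x by (auto simp: \<theta>_def)
  have cb: "\<bar>c M t\<bar> \<le> M" if "M \<ge> 0" for M t using that by (auto simp: c_def)
  have [measurable]: "c M \<in> borel_measurable borel" "\<theta> M \<in> borel_measurable borel" for M
    unfolding c_def[abs_def] \<theta>_def[abs_def] by measurable
  have "(\<lambda>n. \<integral>x. (D x - c (real n) (D x) * \<theta> (real n) x)\<^sup>2 \<partial>lborel) \<longlonglongrightarrow> (\<integral>x. 0 \<partial>(lborel::'a measure))"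
  proof (rule integral_dominated_convergence[where w = "\<lambda>x. (D x)\<^sup>2"])
    show "AE x in lborel. (\<lambda>n. (D x - c (real n) (D x) * \<theta> (real n) x)\<^sup>2) \<longlonglongrightarrow> 0"
    proof (rule AE_I2, rule tendsto_eventually)
      fix x :: 'a
      obtain n0 :: nat where n0: "\<bar>D x\<bar> + norm x < real n0" using reals_Archimedean2 by blast
      have "(D x - c (real n) (D x) * \<theta> (real n) x)\<^sup>2 = 0" if "n \<ge> n0" for n
      proof -
        have *: "\<bar>D x\<bar> + norm x < real n" using n0 that by (meson less_le_trans of_nat_mono)
        have "c (real n) (D x) = D x" using * norm_ge_zero[of x] unfolding c_def by linarith
        moreover have "\<theta> (real n) x = 1" using * by (simp add: \<theta>_def)
        ultimately show ?thesis by simp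
      qed
      then show "\<forall>\<^sub>F n in sequentially. (D x - c (real n) (D x) * \<theta> (real n) x)\<^sup>2 = 0"
        by (auto simp: eventually_sequentially)
    qed
    show "AE x in lborel. norm ((D x - c (real n) (D x) * \<theta> (real n) x)\<^sup>2) \<le> (D x)\<^sup>2" for n
    proof (rule AE_I2)
      fix x
      have "\<bar>D x - c (real n) (D x) * \<theta> (real n) x\<bar> \<le> \<bar>D x\<bar>"
      proof (cases "D x \<ge> 0")
        case True
        then have "0 \<le> c (real n) (D x)" "c (real n) (D x) \<le> D x" by (auto simp: c_def)
        then show ?thesis using True \<theta>[of n x] mult_left_le[of "\<theta> n x" "c (real n) (D x)"] by simp
      next
        case False
        then have a: "0 \<le> - c (real n) (D x)" "- c (real n) (D x) \<le> - D x" by (auto simp: c_def)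
        have "0 \<le> - c (real n) (D x) * \<theta> n x" by (rule mult_nonneg_nonneg[OF a(1) \<theta>(1)])
        then show ?thesis using False a \<theta>[of n x] mult_left_le[of "\<theta> n x" "- c (real n) (D x)"] by simp
      qed
      then show "norm ((D x - c (real n) (D x) * \<theta> (real n) x)\<^sup>2) \<le> (D x)\<^sup>2"
        by (simp add: abs_le_square_iff)
    qed
  qed (use D2 in measurable)
  then have "\<forall>\<^sub>F n in sequentially. (\<integral>x. (D x - c (real n) (D x) * \<theta> (real n) x)\<^sup>2 \<partial>lborel) < e / 4"
    by (rule order_tendstoD(2)) (use e in simp)
  then obtain n where "(\<integral>x. (D x - c (real n) (D x) * \<theta> (real n) x)\<^sup>2 \<partial>lborel) < e / 4"
    using eventually_happens'[OF sequentially_bot] by blast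
  then obtain M :: real where M: "M \<ge> 0"
      and M1: "(\<integral>x. (D x - c M (D x) * \<theta> M x)\<^sup>2 \<partial>lborel) < e / 4"
    using that[of "real n"] by simp
  \<comment> \<open>A Lebesgue measurable function is an almost everywhere limit of continuous
    functions.\<close>
  have "D \<in> borel_measurable lebesgue" by (rule measurable_completion) simp
  then have "D measurable_on UNIV"
    using lebesgue_measurable_imp_measurable_on[of D UNIV] sets.top[of lebesgue] by simp
  then obtain N g where N: "negligible N" and g: "\<And>n. continuous_on UNIV (g n)"
      and lim: "\<And>x. x \<notin> N \<Longrightarrow> (\<lambda>n. g n x) \<longlonglongrightarrow> D x"
    by (auto simp: measurable_on_def)
  have [measurable]: "g n \<in> borel_measurable borel" for n
    using g by (simp add: borel_measurable_continuous_onI)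
  \<comment> \<open>Truncating the approximants exactly like \<open>D\<close> gives them compact
    support and the common bound \<open>M\<close>, hence a dominating function.\<close>
  have ck: "compact_kernel (M + 1) (\<lambda>x. c M (g n x) * \<theta> M x)" for n
    unfolding compact_kernel_def c_def \<theta>_def using g by (auto intro!: continuous_intros)
  have "(\<lambda>n. \<integral>x. (c M (D x) * \<theta> M x - c M (g n x) * \<theta> M x)\<^sup>2 \<partial>lborel) \<longlonglongrightarrow> (\<integral>x. 0 \<partial>(lborel::'a measure))"
  proof (rule integral_dominated_convergence[where w = "\<lambda>x. (2 * M)\<^sup>2 * indicator (cball 0 (M + 1)) x"])
    show "integrable lborel (\<lambda>x::'a. (2 * M)\<^sup>2 * indicator (cball 0 (M + 1)) x)"
      using emeasure_lborel_cball_finite by (intro integrable_mult_right integrable_real_indicator) auto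
    have "AE x in lebesgue. x \<notin> N" using N
      by (simp add: negligible_iff_null_sets AE_not_in)
    then have "AE x in lborel. x \<notin> N" by (simp add: AE_completion_iff)
    then show "AE x in lborel. (\<lambda>n. (c M (D x) * \<theta> M x - c M (g n x) * \<theta> M x)\<^sup>2) \<longlonglongrightarrow> 0"
    proof eventually_elim
      case (elim x)
      have "(\<lambda>n. (c M (D x) * \<theta> M x - c M (g n x) * \<theta> M x)\<^sup>2) \<longlonglongrightarrow> (c M (D x) * \<theta> M x - c M (D x) * \<theta> M x)\<^sup>2"
        unfolding c_def by (intro tendsto_intros lim elim)
      then show ?case by simp
    qed
    show "AE x in lborel. norm ((c M (D x) * \<theta> M x - c M (g n x) * \<theta> M x)\<^sup>2)
        \<le> (2 * M)\<^sup>2 * indicator (cball 0 (M + 1)) x" for n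
    proof (rule AE_I2)
      fix x :: 'a
      show "norm ((c M (D x) * \<theta> M x - c M (g n x) * \<theta> M x)\<^sup>2)
        \<le> (2 * M)\<^sup>2 * indicator (cball 0 (M + 1)) x"
      proof (cases "x \<in> cball 0 (M + 1)")
        case True
        have "\<bar>c M (D x) * \<theta> M x - c M (g n x) * \<theta> M x\<bar> = \<bar>c M (D x) - c M (g n x)\<bar> * \<theta> M x"
          using \<theta>[of M x] by (simp add: left_diff_distrib[symmetric] abs_mult)
        also have "\<dots> \<le> (2 * M) * 1"
          using cb[OF M, of "D x"] cb[OF M, of "g n x"] \<theta>[of M x] M by (intro mult_mono) auto
        finally have "(c M (D x) * \<theta> M x - c M (g n x) * \<theta> M x)\<^sup>2 \<le> (2 * M)\<^sup>2"
          by (intro iffD1[OF abs_le_square_iff]) simp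
        then show ?thesis using True by simp
      next
        case False
        then have "\<theta> M x = 0" by (simp add: \<theta>_def)
        then show ?thesis by simp
      qed
    qed
  qed measurable
  then have "\<forall>\<^sub>F n in sequentially. (\<integral>x. (c M (D x) * \<theta> M x - c M (g n x) * \<theta> M x)\<^sup>2 \<partial>lborel) < e / 4"
    by (rule order_tendstoD(2)) (use e in simp)
  then obtain n where n: "(\<integral>x. (c M (D x) * \<theta> M x - c M (g n x) * \<theta> M x)\<^sup>2 \<partial>lborel) < e / 4"
    using eventually_happens'[OF sequentially_bot] by blast
  define f where "f x = c M (g n x) * \<theta> M x" for x
  define p where "p x = c M (D x) * \<theta> M x" for x
  have f: "compact_kernel (M + 1) f" using ck[of n] by (simp add: f_def[abs_def])
  have p: "sq_integrable p"
    unfolding sq_integrable_def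
  proof
    show [measurable]: "p \<in> borel_measurable borel" unfolding p_def by measurable
    show "integrable lborel (\<lambda>x. (p x)\<^sup>2)"
    proof (rule Bochner_Integration.integrable_bound)
      show "integrable lborel (\<lambda>x::'a. M\<^sup>2 * indicator (cball 0 (M + 1)) x)"
        using emeasure_lborel_cball_finite by (intro integrable_mult_right integrable_real_indicator) auto
      show "AE x in lborel. norm ((p x)\<^sup>2) \<le> norm (M\<^sup>2 * indicator (cball 0 (M + 1)) x)"
      proof (rule AE_I2)
        fix x :: 'a
        have "\<bar>p x\<bar> \<le> M * 1"
          unfolding p_def abs_mult using cb[OF M, of "D x"] \<theta>[of M x] M by (intro mult_mono) auto
        then have "(p x)\<^sup>2 \<le> M\<^sup>2" using M by (intro iffD1[OF abs_le_square_iff]) simp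
        moreover have "p x = 0" if "x \<notin> cball 0 (M + 1)" using that by (simp add: p_def \<theta>_def)
        ultimately show "norm ((p x)\<^sup>2) \<le> norm (M\<^sup>2 * indicator (cball 0 (M + 1)) x)"
          by (cases "x \<in> cball 0 (M + 1)") auto
      qed
    qed measurable
  qed
  note Dp = sq_integrable_diff[OF D p]
    and pf = sq_integrable_diff[OF p compact_kernel_sq_integrable[OF f]]
    and Df = sq_integrable_diff[OF D compact_kernel_sq_integrable[OF f]]
  \<comment> \<open>Both errors are below e / 4, so the factors 2 from splitting the square still
    leave a total below e.\<close>
  have "(D x - f x)\<^sup>2 \<le> 2 * (D x - p x)\<^sup>2 + 2 * (p x - f x)\<^sup>2" for x
    using sum_squares_bound[of "D x - p x" "p x - f x"] by (simp add: power2_eq_square algebra_simps)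
  then have "(\<integral>x. (D x - f x)\<^sup>2 \<partial>lborel) \<le> (\<integral>x. 2 * (D x - p x)\<^sup>2 + 2 * (p x - f x)\<^sup>2 \<partial>lborel)"
    using Dp pf Df by (intro integral_mono) (auto simp: sq_integrable_def)
  also have "\<dots> = 2 * (\<integral>x. (D x - p x)\<^sup>2 \<partial>lborel) + 2 * (\<integral>x. (p x - f x)\<^sup>2 \<partial>lborel)"
    using Dp pf by (simp add: sq_integrable_def)
  also have "\<dots> < e" using M1 n by (simp add: p_def f_def)
  finally show thesis using that[OF f] by blast
qed

text \<open>
  Expanding the square of D - f for a continuous compactly supported f close to D, it suffices that
  2 \<integral> D f - \<integral> f^2 \<le> C up to a small error, and there D may be replaced by its mollification because
  f converges uniformly under mollification.
\<close>

lemma sq_integral_le_of_convol_le: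
  fixes D :: "'a::euclidean_space \<Rightarrow> real"
  assumes D: "sq_integrable D"
    and C: "\<And>\<eta>. \<eta> > 0 \<Longrightarrow> \<exists>K. prob_kernel \<eta> K \<and> (\<forall>x. K (- x) = K x) \<and>
      (\<integral>x. (convol K D x)\<^sup>2 \<partial>lborel) \<le> C"
  shows "(\<integral>x. (D x)\<^sup>2 \<partial>lborel) \<le> C"
proof (rule field_le_epsilon)
  fix e :: real assume e: "e > 0"
  obtain R f where f: "compact_kernel R f" and fe: "(\<integral>x. (D x - f x)\<^sup>2 \<partial>lborel) < e / 2"
    using compact_kernel_dense[OF D, of "e / 2"] e by auto
  \<comment> \<open>Both \<open>f\<close> and its mollification vanish outside the ball of radius R
    + 1 once \<eta> \<le> 1. The mollification error of \<open>f\<close> is therefore paired with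
    |D| on this ball only, where |D| is integrable.\<close>
  define w where "w x = \<bar>D x\<bar> * indicator (cball 0 (R + 1)) x" for x
  have ind: "sq_integrable (indicator (cball 0 (R + 1)) :: 'a \<Rightarrow> real)"
    using emeasure_lborel_cball_finite
    by (auto simp: sq_integrable_def power2_eq_square simp flip: indicator_inter_arith
      intro!: integrable_real_indicator borel_measurable_indicator)
  have "integrable lborel (\<lambda>x. \<bar>D x * indicator (cball 0 (R + 1)) x\<bar>)"
    using sq_integrable_mult[OF D ind] by simp
  then have w: "integrable lborel w" unfolding w_def[abs_def] by (simp add: abs_mult)
  define A where "A = (\<integral>x. w x \<partial>lborel)"
  have A0: "A \<ge> 0" unfolding A_def w_def by (intro integral_nonneg_AE) auto
  \<comment> \<open>This makes \<omega> A \<le> e / 4; the denominator uses A + 1 because A may be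
    0.\<close>
  define \<omega> where "\<omega> = e / (4 * (A + 1))"
  have \<omega>: "\<omega> > 0" using e A0 by (simp add: \<omega>_def)
  obtain d where d: "d > 0" "\<And>x y. dist x y \<le> d \<Longrightarrow> \<bar>f x - f y\<bar> < \<omega>"
    using compact_kernel_uniformly_continuous[OF f \<omega>] by blast
  define \<eta> where "\<eta> = min d 1"
  have \<eta>: "\<eta> > 0" "\<eta> \<le> 1" "\<eta> \<le> d" using d by (auto simp: \<eta>_def)
  obtain K where K: "prob_kernel \<eta> K" and Ke: "\<And>x. K (- x) = K x"
      and KC: "(\<integral>x. (convol K D x)\<^sup>2 \<partial>lborel) \<le> C"
    using C[OF \<eta>(1)] by blast
  have ck: "compact_kernel \<eta> K" using K by (simp add: prob_kernel_def)
  note fs = compact_kernel_sq_integrable[OF f]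
  note KDs = sq_integrable_convol[OF K D] and Kfs = sq_integrable_convol[OF K fs]
  have \<rho>s: "sq_integrable (\<lambda>x. convol K f x - f x)" by (rule sq_integrable_diff[OF Kfs fs])
  have "\<bar>\<integral>x. D x * (convol K f x - f x) \<partial>lborel\<bar> \<le> (\<integral>x. \<omega> * w x \<partial>lborel)"
  proof (rule order_trans[OF integral_abs_bound], rule integral_mono)
    show "integrable lborel (\<lambda>x. \<bar>D x * (convol K f x - f x)\<bar>)"
      using sq_integrable_mult[OF D \<rho>s] by simp
    show "integrable lborel (\<lambda>x. \<omega> * w x)" using w by simp
    fix x :: 'a
    show "\<bar>D x * (convol K f x - f x)\<bar> \<le> \<omega> * w x"
    proof (cases "x \<in> cball 0 (R + 1)")
      case True
      have "\<bar>convol K f x - f x\<bar> \<le> \<omega>"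
        using d(2) \<eta>(3) by (intro convol_uniform_approx[OF K f]) (meson less_imp_le order_trans)
      then show ?thesis
        using True mult_left_mono[of "\<bar>convol K f x - f x\<bar>" \<omega> "\<bar>D x\<bar>"]
        by (simp add: abs_mult w_def mult.commute)
    next
      case False
      then have "R + \<eta> < norm x" using \<eta>(2) by auto
      then have "convol K f x = 0" "f x = 0"
        using convol_support[OF K f] f \<eta>(1) by (auto simp: compact_kernel_def)
      then show ?thesis using \<omega> by (simp add: w_def)
    qed
  qed
  also have "\<dots> = \<omega> * A" by (simp add: A_def)
  also have "\<dots> \<le> e / 4"
    using A0 e by (simp add: \<omega>_def field_simps)
  finally have err: "\<bar>\<integral>x. D x * (convol K f x - f x) \<partial>lborel\<bar> \<le> e / 4" .
  have "(\<integral>x. D x * (convol K f x - f x) \<partial>lborel)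
      = (\<integral>x. D x * convol K f x \<partial>lborel) - (\<integral>x. D x * f x \<partial>lborel)"
    unfolding right_diff_distrib
    by (rule Bochner_Integration.integral_diff[OF sq_integrable_mult[OF D Kfs] sq_integrable_mult[OF D fs]])
  also have "(\<integral>x. D x * convol K f x \<partial>lborel) = (\<integral>x. f x * convol K D x \<partial>lborel)"
    using integral_mult_convol[OF D fs ck] by (simp add: Ke)
  finally have 1: "(\<integral>x. D x * f x \<partial>lborel) \<le> (\<integral>x. f x * convol K D x \<partial>lborel) + e / 4"
    using err by linarith
  \<comment> \<open>Young with weight 1. Its \<integral> f^2 cancels below against that in
    \<integral> D^2 = \<integral> (D - f)^2 + 2 \<integral> D f - \<integral> f^2. What remains is
    C, e / 2 from the density step and twice e / 4 from \<open>err\<close>.\<close>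
  have 2: "2 * (\<integral>x. f x * convol K D x \<partial>lborel) \<le> (\<integral>x. (f x)\<^sup>2 \<partial>lborel) + C"
    using integral_mult_le_square[OF fs KDs, of 1] KC by linarith
  have "(\<integral>x. (D x - f x)\<^sup>2 \<partial>lborel)
      = (\<integral>x. (D x)\<^sup>2 + (f x)\<^sup>2 - 2 * (D x * f x) \<partial>lborel)"
    by (simp add: power2_diff mult.assoc)
  also have "\<dots> = (\<integral>x. (D x)\<^sup>2 \<partial>lborel) + (\<integral>x. (f x)\<^sup>2 \<partial>lborel) - 2 * (\<integral>x. D x * f x \<partial>lborel)"
    using D fs sq_integrable_mult[OF D fs] by (simp add: sq_integrable_def)
  finally show "(\<integral>x. (D x)\<^sup>2 \<partial>lborel) \<le> C + e"
    using 1 2 fe by linarith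
qed

section \<open>Test functions and weak derivatives\<close>

lemma test_fun_continuous: "test_fun f df \<Longrightarrow> continuous_on UNIV f"
  unfolding test_fun_def
  by (intro has_derivative_continuous_on[where f' = "\<lambda>x v. df x \<bullet> v"]) (simp add: has_derivative_at_withinI)

text \<open>\<open>test_fun\<close> bounds only the support of \<open>f\<close>. Outside a ball
  \<open>f\<close> is locally zero, so uniqueness of the derivative makes the gradient vanish there
  as well.\<close>

lemma test_fun_compact_kernel:
  assumes f: "test_fun f df"
  obtains R where "compact_kernel R f" "\<And>i. compact_kernel R (\<lambda>x. df x $ i)"
proof -
  have d: "(f has_derivative (\<lambda>v. df x \<bullet> v)) (at x)" and c: "continuous_on UNIV df" for x
    using f by (auto simp: test_fun_def)
  obtain R where R: "\<And>x. f x \<noteq> 0 \<Longrightarrow> norm x \<le> R"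
    using f by (auto simp: test_fun_def bounded_iff)
  then have z: "f x = 0" if "R < norm x" for x using that by (meson not_le)
  have "df x = 0" if x: "R < norm x" for x
  proof -
    have "open {x::real^2. R < norm x}" by (intro open_Collect_less continuous_intros)
    then have "((\<lambda>x. 0) has_derivative (\<lambda>v. df x \<bullet> v)) (at x)"
      by (rule has_derivative_transform_within_open[OF d]) (use x z in auto)
    then have "(\<lambda>v. df x \<bullet> v) = (\<lambda>v. 0)"
      by (rule has_derivative_unique) (rule has_derivative_const)
    then have "df x \<bullet> df x = 0" by meson
    then show ?thesis by simp
  qed
  with z c test_fun_continuous[OF f] show thesis
    by (intro that[of R]) (auto simp: compact_kernel_def intro!: continuous_intros)
qed

lemma test_fun_reflect:
  assumes f: "test_fun f df"
  shows "test_fun (\<lambda>z. f (x - z)) (\<lambda>z. - df (x - z))"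
proof -
  have d: "(f has_derivative (\<lambda>v. df y \<bullet> v)) (at y)" and c: "continuous_on UNIV df" for y
    using f by (auto simp: test_fun_def)
  obtain R where R: "\<And>x. f x \<noteq> 0 \<Longrightarrow> norm x \<le> R"
    using f by (auto simp: test_fun_def bounded_iff)
  have "((\<lambda>z. f (x - z)) has_derivative (\<lambda>v. - df (x - z) \<bullet> v)) (at z)" for z
  proof -
    have "((\<lambda>z. x - z) has_derivative (\<lambda>v. - v)) (at z)"
      by (auto intro!: derivative_eq_intros)
    from has_derivative_compose[OF this d] show ?thesis by simp
  qed
  moreover have "continuous_on UNIV (\<lambda>z. - df (x - z))"
    by (intro continuous_on_minus continuous_on_compose2[OF c]) (auto intro!: continuous_intros)
  moreover have "norm z \<le> R + norm x" if "f (x - z) \<noteq> 0" for z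
    using R[OF that] norm_triangle_sub[of z x] by (simp add: norm_minus_commute)
  then have "bounded {z. f (x - z) \<noteq> 0}" by (intro boundedI) auto
  ultimately show ?thesis by (simp add: test_fun_def)
qed

text \<open>
  A difference f - f(\<cdot> - y) is the derivative in direction y of the average of f over segments of
  direction y. This average is again a test function, so it can be used to estimate translates of
  weakly differentiable functions.
\<close>

definition segment_average :: "real^2 \<Rightarrow> (real^2 \<Rightarrow> 'b::banach) \<Rightarrow> real^2 \<Rightarrow> 'b" where
  "segment_average y f w = integral (cbox 0 1) (\<lambda>s. f (w - s *\<^sub>R y))"

lemma segment_average_continuous:
  assumes "continuous_on UNIV f"
  shows "continuous_on UNIV (segment_average y f)"
  unfolding segment_average_def[abs_def]
  by (rule integral_continuous_on_param)
    (auto simp: split_beta intro!: continuous_on_compose2[OF assms] continuous_intros)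

lemma continuous_on_segment:
  fixes y :: "'a::real_normed_vector"
  shows "continuous_on UNIV f \<Longrightarrow> continuous_on S (\<lambda>s::real. f (w - s *\<^sub>R y))"
  by (erule continuous_on_compose2) (auto intro!: continuous_intros)

lemma segment_average_support:
  assumes "\<And>x. R < norm x \<Longrightarrow> f x = 0" "R + norm y < norm w"
  shows "segment_average y f w = 0"
proof -
  have "f (w - s *\<^sub>R y) = 0" if "s \<in> cbox 0 1" for s :: real
  proof (rule assms(1))
    have "norm (s *\<^sub>R y) \<le> norm y" using that by (auto intro: mult_left_le_one_le)
    then show "R < norm (w - s *\<^sub>R y)"
      using assms(2) norm_triangle_ineq2[of w "s *\<^sub>R y"] by linarith
  qed
  then have "integral (cbox 0 1) (\<lambda>s. f (w - s *\<^sub>R y)) = integral (cbox 0 1) (\<lambda>s::real. 0)"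
    by (intro integral_cong) auto
  then show ?thesis by (simp add: segment_average_def)
qed

lemma segment_average_compact_kernel:
  "compact_kernel R f \<Longrightarrow> compact_kernel (R + norm y) (segment_average y f)"
  using segment_average_continuous[of f y] segment_average_support[of R f y]
  by (auto simp: compact_kernel_def)

text \<open>Differentiation under the integral sign. The Leibniz rule asks for an operator-valued
  derivative, so the gradient is wrapped by \<open>blinfun_inner_right\<close> and afterwards pulled
  out of the integral by linearity.\<close>

lemma segment_average_test_fun:
  assumes f: "test_fun f df"
  shows "test_fun (segment_average y f) (segment_average y df)"
proof -
  have d: "(f has_derivative (\<lambda>v. df x \<bullet> v)) (at x)" and c: "continuous_on UNIV df" for x
    using f by (auto simp: test_fun_def)
  have "(segment_average y f has_derivative (\<lambda>v. segment_average y df x \<bullet> v)) (at x)" for x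
  proof -
    have "((\<lambda>x. integral (cbox 0 1) (\<lambda>s. f (x - s *\<^sub>R y))) has_derivative
      integral (cbox (0::real) 1) (\<lambda>s. blinfun_inner_right (df (x - s *\<^sub>R y)))) (at x within UNIV)"
    proof (rule leibniz_rule)
      fix x and s :: real
      have "((\<lambda>x. x - s *\<^sub>R y) has_derivative (\<lambda>v. v)) (at x)"
        by (auto intro!: derivative_eq_intros)
      from has_derivative_compose[OF this d]
      show "((\<lambda>x. f (x - s *\<^sub>R y)) has_derivative blinfun_apply (blinfun_inner_right (df (x - s *\<^sub>R y)))) (at x within UNIV)"
        by simp
    next
      fix x show "(\<lambda>s. f (x - s *\<^sub>R y)) integrable_on cbox 0 1"
        by (intro integrable_continuous continuous_on_segment test_fun_continuous[OF f])
    next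
      show "continuous_on (UNIV \<times> cbox 0 1) (\<lambda>(x, s). blinfun_inner_right (df (x - s *\<^sub>R y)))"
        unfolding split_beta
        by (intro bounded_linear.continuous_on[OF bounded_linear_blinfun_inner_right]
            continuous_on_compose2[OF c] continuous_intros) auto
    qed auto
    also have "integral (cbox (0::real) 1) (\<lambda>s. blinfun_inner_right (df (x - s *\<^sub>R y)))
        = blinfun_inner_right (segment_average y df x)"
      unfolding segment_average_def
      using integral_linear[OF integrable_continuous[OF continuous_on_segment[OF c]]
          bounded_linear_blinfun_inner_right, of 0 1 x y]
      by (simp add: o_def)
    finally show ?thesis by (simp add: segment_average_def[abs_def])
  qed
  moreover obtain R where "compact_kernel R f" using test_fun_compact_kernel[OF f] by blast
  then have "segment_average y f x = 0" if "R + norm y < norm x" for x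
    using that segment_average_compact_kernel[of R f y] by (simp add: compact_kernel_def)
  then have "bounded {x. segment_average y f x \<noteq> 0}"
    by (intro boundedI[of _ "R + norm y"]) (auto simp: not_less[symmetric])
  ultimately show ?thesis
    using segment_average_continuous[OF c] by (simp add: test_fun_def)
qed

lemma segment_average_inner:
  assumes c: "continuous_on UNIV df"
  shows "y \<bullet> segment_average y df w = segment_average y (\<lambda>x. y \<bullet> df x) w"
  unfolding segment_average_def
  using integral_linear[OF integrable_continuous[OF continuous_on_segment[OF c]]
    bounded_linear_inner_right[of y], of 0 1 w y]
  by (simp add: o_def)

text \<open>Fundamental theorem of calculus along the segment:
  \<open>- f (w - s *\<^sub>R y)\<close> has \<open>s\<close>-derivative
  \<open>y \<bullet> df (w - s *\<^sub>R y)\<close>.\<close>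

lemma segment_average_derivative:
  assumes f: "test_fun f df"
  shows "segment_average y (\<lambda>x. y \<bullet> df x) w = f w - f (w - y)"
proof -
  have d: "(f has_derivative (\<lambda>v. df x \<bullet> v)) (at x)" for x
    using f by (auto simp: test_fun_def)
  have "((\<lambda>s. y \<bullet> df (w - s *\<^sub>R y)) has_integral (- f (w - 1 *\<^sub>R y)) - (- f (w - 0 *\<^sub>R y))) {0..1}"
  proof (rule fundamental_theorem_of_calculus)
    fix s :: real
    have "((\<lambda>s. w - s *\<^sub>R y) has_derivative (\<lambda>t. - t *\<^sub>R y)) (at s within {0..1})"
      by (auto intro!: derivative_eq_intros)
    from has_derivative_compose[OF this d]
    have "((\<lambda>s. f (w - s *\<^sub>R y)) has_derivative (\<lambda>t. df (w - s *\<^sub>R y) \<bullet> (- t *\<^sub>R y))) (at s within {0..1})" .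
    from has_derivative_minus[OF this]
    show "((\<lambda>s. - f (w - s *\<^sub>R y)) has_vector_derivative y \<bullet> df (w - s *\<^sub>R y)) (at s within {0..1})"
      by (simp add: has_vector_derivative_def inner_commute mult.commute)
  qed simp
  then show ?thesis by (simp add: segment_average_def integral_unique)
qed

text \<open>Fubini in (s, w): every translate has the same integral, and s ranges over an interval
  of length one. Consequently averaging a probability kernel gives a probability kernel.\<close>

lemma integral_segment_average:
  assumes f: "compact_kernel R f"
  shows "(\<integral>w. segment_average y f w \<partial>lborel) = (\<integral>w. f w \<partial>lborel)"
proof -
  have c: "continuous_on UNIV f" using f by (simp add: compact_kernel_def)
  note fI = compact_kernel_integrable[OF f] and [measurable] = compact_kernel_measurable[OF f]
  have P: "integrable (lborel \<Otimes>\<^sub>M lborel) (\<lambda>(s::real, w). indicator {0..1} s * f (w - s *\<^sub>R y))"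
  proof (rule lborel_pair.Fubini_integrable)
    show "(\<lambda>(s::real, w). indicator {0..1} s * f (w - s *\<^sub>R y)) \<in> borel_measurable (lborel \<Otimes>\<^sub>M lborel)"
      by measurable
    have "(\<integral>w. \<bar>f (w - s *\<^sub>R y)\<bar> \<partial>lborel) = (\<integral>w. \<bar>f w\<bar> \<partial>lborel)" for s
      using integral_shift[of "\<lambda>w. \<bar>f w\<bar>" "- (s *\<^sub>R y)"] by simp
    then show "integrable lborel (\<lambda>s. \<integral>w. norm (case (s, w) of (s::real, w) \<Rightarrow> indicator {0..1} s * f (w - s *\<^sub>R y)) \<partial>lborel)"
      by (simp add: abs_mult)
    show "AE s in lborel. integrable lborel (\<lambda>w. case (s, w) of (s::real, w) \<Rightarrow> indicator {0..1} s * f (w - s *\<^sub>R y))"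
      using integrable_shift[of f "- (s *\<^sub>R y)" for s] fI by simp
  qed
  have "segment_average y f w = (\<integral>s. indicator {0..1} s * f (w - s *\<^sub>R y) \<partial>lborel)" for w
    using set_borel_integral_eq_integral(2)[OF borel_integrable_atLeastAtMost'[OF continuous_on_segment[OF c]], of 0 1 w y]
    by (simp add: segment_average_def set_lebesgue_integral_def)
  then have "(\<integral>w. segment_average y f w \<partial>lborel) = (\<integral>s. (\<integral>w. indicator {0..1} s * f (w - s *\<^sub>R y) \<partial>lborel) \<partial>lborel)"
    using lborel_pair.Fubini_integral[OF P] by simp
  also have "\<dots> = (\<integral>s. indicator {0..1::real} s * (\<integral>w. f w \<partial>lborel) \<partial>lborel)"
    using integral_shift[of f "- (s *\<^sub>R y)" for s] by simp
  finally show ?thesis by simp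
qed

lemma segment_average_prob_kernel:
  assumes f: "prob_kernel R f"
  shows "prob_kernel (R + norm y) (segment_average y f)"
proof -
  have k: "compact_kernel R f" and f0: "\<And>x. 0 \<le> f x" using f by (auto simp: prob_kernel_def)
  have "0 \<le> segment_average y f w" for w
    unfolding segment_average_def
    using k f0 by (intro integral_nonneg integrable_continuous continuous_on_segment)
      (auto simp: compact_kernel_def)
  then show ?thesis
    using segment_average_compact_kernel[OF k] integral_segment_average[OF k] f
    by (simp add: prob_kernel_def)
qed

text \<open>Averaging along the i-th unit vector preserves the integral and turns the partial
  derivative into f - f(\<cdot> - y), whose integral vanishes by translation invariance.\<close>

lemma integral_test_fun_derivative:
  assumes f: "test_fun f df"
  shows "(\<integral>x. df x $ i \<partial>lborel) = 0"
proof -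
  obtain R where R: "compact_kernel R f" "\<And>i. compact_kernel R (\<lambda>x. df x $ i)"
    using test_fun_compact_kernel[OF f] by blast
  define y :: "real^2" where "y = axis i 1"
  have y: "y \<bullet> df x = df x $ i" for x by (simp add: y_def inner_axis')
  have "(\<integral>x. df x $ i \<partial>lborel) = (\<integral>w. segment_average y (\<lambda>x. y \<bullet> df x) w \<partial>lborel)"
    using integral_segment_average[OF R(2)[of i], of y] by (simp add: y)
  also have "\<dots> = (\<integral>w. f w - f (w - y) \<partial>lborel)"
    by (simp add: segment_average_derivative[OF f])
  also have "\<dots> = 0"
    using integral_shift[of f "- y"] integrable_shift[of f "- y"]
      compact_kernel_integrable[OF R(1)] compact_kernel_measurable[OF R(1)]
    by simp
  finally show ?thesis .
qed

section \<open>Elementary properties of weak partial derivatives\<close>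

lemma set_integrable_const_compact:
  "compact S \<Longrightarrow> set_integrable lborel S (\<lambda>x::'a::euclidean_space. c::real)"
  unfolding set_integrable_def by (intro borel_integrable_compact) auto

text \<open>Allows passing from n to n - e3 with the same weak gradient: the extra term is c times
  the integral of a derivative of a test function.\<close>

lemma weak_partial_add_const:
  assumes u: "weak_partial u i g"
  shows "weak_partial (\<lambda>x. u x + c) i g"
  unfolding weak_partial_def
proof (intro conjI allI impI)
  fix K :: "(real^2) set" assume K: "compact K"
  show "set_integrable lborel K (\<lambda>x. u x + c)"
    using u K set_integrable_const_compact[OF K] by (intro set_integral_add) (auto simp: weak_partial_def)
  show "set_integrable lborel K g" using u K by (auto simp: weak_partial_def)
next
  fix f df assume f: "test_fun f df"
  obtain R where R: "compact_kernel R f" "\<And>i. compact_kernel R (\<lambda>x. df x $ i)"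
    using test_fun_compact_kernel[OF f] by blast
  \<comment> \<open>\<open>u\<close> is only locally integrable, so it is cut off to the ball that
    supports the test function and its gradient.\<close>
  have "set_integrable lborel (cball 0 R) u" using u by (auto simp: weak_partial_def)
  from integrable_mult_compact_kernel[OF R(2) this[unfolded set_integrable_def], of i]
  have "integrable lborel (\<lambda>x. (indicator (cball 0 R) x *\<^sub>R u x) * df x $ i)" .
  also have "(\<lambda>x. (indicator (cball 0 R) x *\<^sub>R u x) * df x $ i) = (\<lambda>x. u x * df x $ i)"
    using R(2)[of i] by (auto simp: fun_eq_iff compact_kernel_def indicator_def)
  finally have "(\<integral>x. (u x + c) * df x $ i \<partial>lborel) = (\<integral>x. u x * df x $ i \<partial>lborel)"
    using compact_kernel_integrable[OF R(2)] by (simp add: distrib_right integral_test_fun_derivative[OF f])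
  then show "(\<integral>x. (u x + c) * df x $ i \<partial>lborel) = - (\<integral>x. g x * f x \<partial>lborel)"
    using u f by (simp add: weak_partial_def)
qed

lemma weak_partial_const: "weak_partial (\<lambda>x. c) i (\<lambda>x. 0)"
proof -
  have "weak_partial (\<lambda>x. 0) i (\<lambda>x. 0)"
    by (simp add: weak_partial_def set_integrable_def)
  from weak_partial_add_const[OF this, of c] show ?thesis by simp
qed

text \<open>A weak derivative such as \<open>wgrad\<close> is known only through its defining
  property; measurability is extracted from integrability on the balls of integer radius.\<close>

lemma weak_partial_measurable:
  assumes "weak_partial u i g"
  shows "g \<in> borel_measurable borel"
proof (rule borel_measurable_LIMSEQ_real)
  fix x :: "real^2"
  obtain n0 :: nat where n0: "norm x \<le> real n0" using real_arch_simple by blast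
  have "indicator (cball 0 (real n)) x *\<^sub>R g x = g x" if "n \<ge> n0" for n
    using n0 that by (simp add: order_trans[OF n0])
  then have "\<forall>\<^sub>F n in sequentially. indicator (cball 0 (real n)) x *\<^sub>R g x = g x"
    by (auto simp: eventually_sequentially)
  then show "(\<lambda>n. indicator (cball 0 (real n)) x *\<^sub>R g x) \<longlonglongrightarrow> g x"
    by (rule tendsto_eventually)
next
  fix n :: nat
  have "set_integrable lborel (cball 0 (real n)) g" using assms by (auto simp: weak_partial_def)
  then show "(\<lambda>x. indicator (cball 0 (real n)) x *\<^sub>R g x) \<in> borel_measurable borel"
    unfolding set_integrable_def using borel_measurable_integrable by auto
qed

text \<open>The weak derivative is tested with \<open>\<lambda>z. f (x - z)\<close>; the sign from
  the reflection cancels the sign in the definition.\<close>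

lemma convol_weak_partial:
  assumes u: "weak_partial u i g" and f: "test_fun f df"
  shows "convol (\<lambda>x. df x $ i) u x = convol f g x"
proof -
  have "(\<integral>z. u z * (- df (x - z)) $ i \<partial>lborel) = - (\<integral>z. g z * f (x - z) \<partial>lborel)"
    using u test_fun_reflect[OF f, of x] unfolding weak_partial_def by blast
  then show ?thesis by (simp add: convol_def)
qed

text \<open>Both \<open>g\<close> and 0 are weak derivatives of the constant, so their
  mollifications agree. All mollifications of \<open>g\<close> vanish, and the duality bound applies
  with constant 0.\<close>

lemma weak_partial_const_unique:
  assumes g: "weak_partial (\<lambda>x. c) i g" and g2: "sq_integrable g"
  shows "(\<integral>x. (g x)\<^sup>2 \<partial>lborel) = 0"
proof -
  have "(\<integral>x. (g x)\<^sup>2 \<partial>lborel) \<le> 0"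
  proof (rule sq_integral_le_of_convol_le[OF g2])
    fix \<eta> :: real assume "\<eta> > 0"
    then obtain K dK where K: "mollifier \<eta> K dK" by (rule mollifier_exists)
    then have t: "test_fun K dK" by (simp add: mollifier_def)
    have "convol K g x = 0" for x
      using convol_weak_partial[OF g t, of x] convol_weak_partial[OF weak_partial_const[of c] t, of i x]
      by (simp add: convol_def)
    with K show "\<exists>K. prob_kernel \<eta> K \<and> (\<forall>x. K (- x) = K x) \<and> (\<integral>x. (convol K g x)\<^sup>2 \<partial>lborel) \<le> 0"
      by (intro exI[of _ K]) (simp add: mollifier_def)
  qed
  moreover have "(\<integral>x. (g x)\<^sup>2 \<partial>lborel) \<ge> 0" by (intro integral_nonneg_AE) auto
  ultimately show ?thesis by linarith
qed

section \<open>Square-integrable functions with square-integrable weak gradient\<close>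

text \<open>The space H^1 with the gradient carried as data, so that the representative chosen by
  \<open>wgrad\<close> can be used throughout.\<close>

definition sobolev :: "(real^2 \<Rightarrow> real) \<Rightarrow> (2 \<Rightarrow> real^2 \<Rightarrow> real) \<Rightarrow> bool" where
  "sobolev u g \<longleftrightarrow> sq_integrable u \<and> (\<forall>i. sq_integrable (g i) \<and> weak_partial u i (g i))"

definition grad_energy :: "(2 \<Rightarrow> real^2 \<Rightarrow> real) \<Rightarrow> real" where
  "grad_energy g = (\<Sum>i\<in>UNIV. \<integral>x. (g i x)\<^sup>2 \<partial>lborel)"

lemma grad_energy_nonneg: "grad_energy g \<ge> 0"
  unfolding grad_energy_def by (intro sum_nonneg integral_nonneg_AE) auto

lemma sq_integrable_sum:
  "(\<And>i. i \<in> I \<Longrightarrow> sq_integrable (f i)) \<Longrightarrow> sq_integrable (\<lambda>x. \<Sum>i\<in>I. f i x)"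
proof (induction I rule: infinite_finite_induct)
  case (insert i I)
  then show ?case by (simp add: sq_integrable_add)
qed (simp_all add: sq_integrable_def)

text \<open>The difference is moved onto the kernel, where K v - K (v - y) is the derivative in
  direction y of the test function \<open>segment_average y K\<close>; the weak gradient then takes
  this derivative over. The computation runs from right to left.\<close>

lemma convol_translate_diff:
  assumes u: "sobolev u g" and K: "mollifier \<eta> K dK"
  shows "convol K (\<lambda>z. u z - u (z - y)) x
    = convol (segment_average y K) (\<lambda>z. \<Sum>i\<in>UNIV. y $ i * g i z) x"
proof -
  have t: "test_fun K dK" and k: "compact_kernel \<eta> K"
    using K by (auto simp: mollifier_def prob_kernel_def)
  have u2: "sq_integrable u" and gi: "\<And>i. sq_integrable (g i)" and w: "\<And>i. weak_partial u i (g i)"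
    using u by (auto simp: sobolev_def)
  define A where "A = segment_average y K"
  define dA where "dA = segment_average y dK"
  have tA: "test_fun A dA" unfolding A_def dA_def by (rule segment_average_test_fun[OF t])
  obtain R where R: "compact_kernel R A" "\<And>i. compact_kernel R (\<lambda>x. dA x $ i)"
    using test_fun_compact_kernel[OF tA] by blast
  have c: "continuous_on UNIV dK" using t by (simp add: test_fun_def)
  have yd: "(\<Sum>i\<in>UNIV. y $ i * dA v $ i) = K v - K (v - y)" for v
    using segment_average_inner[OF c, of y v] segment_average_derivative[OF t, of y v]
    by (simp add: dA_def inner_vec_def)
  have Iu: "integrable lborel (\<lambda>z. u z * dA (x - z) $ i)" for i
    by (rule sq_integrable_mult[OF u2 compact_kernel_sq_integrable[OF compact_kernel_translate[OF R(2)]]])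
  have Ig: "integrable lborel (\<lambda>z. g i z * A (x - z))" for i
    by (rule sq_integrable_mult[OF gi compact_kernel_sq_integrable[OF compact_kernel_translate[OF R(1)]]])
  note [measurable] = compact_kernel_measurable[OF k]
  have um[measurable]: "u \<in> borel_measurable borel" using u2 by (simp add: sq_integrable_def)
  have uK: "integrable lborel (\<lambda>z. u z * K (x - z))" for x
    by (rule sq_integrable_mult[OF u2 compact_kernel_sq_integrable[OF compact_kernel_translate[OF k]]])
  have uK': "integrable lborel (\<lambda>z. u (z - y) * K (x - z))"
    using integrable_shift[of "\<lambda>z. u (z - y) * K (x - z)" y] uK[of "x - y"] by (simp add: algebra_simps)
  have "convol A (\<lambda>z. \<Sum>i\<in>UNIV. y $ i * g i z) x = (\<integral>z. (\<Sum>i\<in>UNIV. y $ i * (g i z * A (x - z))) \<partial>lborel)"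
    by (simp add: convol_def sum_distrib_right mult.assoc)
  also have "\<dots> = (\<Sum>i\<in>UNIV. y $ i * convol A (g i) x)"
    using Ig by (subst Bochner_Integration.integral_sum) (auto simp: convol_def)
  also have "\<dots> = (\<Sum>i\<in>UNIV. y $ i * convol (\<lambda>x. dA x $ i) u x)"
    by (simp add: convol_weak_partial[OF w tA])
  also have "\<dots> = (\<integral>z. (\<Sum>i\<in>UNIV. y $ i * (u z * dA (x - z) $ i)) \<partial>lborel)"
    using Iu by (subst Bochner_Integration.integral_sum) (auto simp: convol_def)
  also have "\<dots> = (\<integral>z. u z * K (x - z) - u z * K (x - y - z) \<partial>lborel)"
  proof (rule Bochner_Integration.integral_cong[OF refl])
    fix z
    have "(\<Sum>i\<in>UNIV. y $ i * (u z * dA (x - z) $ i)) = u z * (\<Sum>i\<in>UNIV. y $ i * dA (x - z) $ i)"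
      by (simp add: sum_distrib_left mult_ac)
    then show "(\<Sum>i\<in>UNIV. y $ i * (u z * dA (x - z) $ i)) = u z * K (x - z) - u z * K (x - y - z)"
      by (simp add: yd right_diff_distrib algebra_simps)
  qed
  also have "\<dots> = (\<integral>z. u z * K (x - z) \<partial>lborel) - (\<integral>z. u z * K (x - y - z) \<partial>lborel)"
    by (rule Bochner_Integration.integral_diff[OF uK uK])
  also have "(\<integral>z. u z * K (x - y - z) \<partial>lborel) = (\<integral>z. u (z - y) * K (x - z) \<partial>lborel)"
    using integral_shift[of "\<lambda>z. u (z - y) * K (x - z)" y] by (simp add: algebra_simps)
  also have "(\<integral>z. u z * K (x - z) \<partial>lborel) - \<dots> = convol K (\<lambda>z. u z - u (z - y)) x"
    unfolding convol_def left_diff_distrib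
    by (rule Bochner_Integration.integral_diff[OF uK uK', symmetric])
  finally show ?thesis by (simp add: A_def)
qed

text \<open>Every mollification of the difference is a probability average of y \<bullet> grad u, so
  L^2 contraction and Cauchy-Schwarz bound it uniformly in the scale. The duality bound then removes
  the mollifier.\<close>

lemma sobolev_translate:
  assumes u: "sobolev u g"
  shows "(\<integral>z. (u z - u (z - y))\<^sup>2 \<partial>lborel) \<le> (norm y)\<^sup>2 * grad_energy g"
proof (rule sq_integral_le_of_convol_le)
  have u2: "sq_integrable u" and gi: "\<And>i. sq_integrable (g i)"
    using u by (auto simp: sobolev_def)
  show "sq_integrable (\<lambda>z. u z - u (z - y))"
    using sq_integrable_diff[OF u2 sq_integrable_shift[OF u2, of "- y"]] by simp
  fix \<eta> :: real assume "\<eta> > 0"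
  then obtain K dK where K: "mollifier \<eta> K dK" by (rule mollifier_exists)
  define G where "G z = (\<Sum>i\<in>UNIV. y $ i * g i z)" for z
  have G: "sq_integrable G"
    unfolding G_def[abs_def] by (intro sq_integrable_sum sq_integrable_cmult gi)
  have "(\<integral>x. (convol K (\<lambda>z. u z - u (z - y)) x)\<^sup>2 \<partial>lborel)
      = (\<integral>x. (convol (segment_average y K) G x)\<^sup>2 \<partial>lborel)"
    by (simp add: convol_translate_diff[OF u K] G_def[abs_def])
  also have "\<dots> \<le> (\<integral>x. (G x)\<^sup>2 \<partial>lborel)"
    using K by (intro sq_integral_convol_le[OF segment_average_prob_kernel G]) (auto simp: mollifier_def)
  also have "\<dots> \<le> (\<integral>x. (norm y)\<^sup>2 * (\<Sum>i\<in>UNIV. (g i x)\<^sup>2) \<partial>lborel)"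
  proof (rule integral_mono)
    show "integrable lborel (\<lambda>x. (G x)\<^sup>2)" using G by (simp add: sq_integrable_def)
    show "integrable lborel (\<lambda>x. (norm y)\<^sup>2 * (\<Sum>i\<in>UNIV. (g i x)\<^sup>2))"
      using gi by (simp add: sq_integrable_def)
    have "(norm y)\<^sup>2 = (\<Sum>i\<in>UNIV. (y $ i)\<^sup>2)"
      unfolding power2_norm_eq_inner by (simp add: inner_vec_def power2_eq_square)
    then show "(G x)\<^sup>2 \<le> (norm y)\<^sup>2 * (\<Sum>i\<in>UNIV. (g i x)\<^sup>2)" for x
      using Cauchy_Schwarz_ineq_sum[of "\<lambda>i. y $ i" "\<lambda>i. g i x" UNIV] by (simp add: G_def)
  qed
  also have "\<dots> = (norm y)\<^sup>2 * grad_energy g"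
    using gi by (simp add: grad_energy_def sq_integrable_def Bochner_Integration.integral_sum)
  finally show "\<exists>K. prob_kernel \<eta> K \<and> (\<forall>x. K (- x) = K x) \<and>
      (\<integral>x. (convol K (\<lambda>z. u z - u (z - y)) x)\<^sup>2 \<partial>lborel) \<le> (norm y)\<^sup>2 * grad_energy g"
    using K by (intro exI[of _ K]) (simp add: mollifier_def)
qed

text \<open>u - K * u is the \<open>K\<close>-average over y of u - u(\<cdot> - y). Jensen and
  Fubini reduce its L^2 norm to the translation estimate with |y| \<le> \<eta>.\<close>

lemma sobolev_convol_error:
  assumes u: "sobolev u g" and K: "prob_kernel \<eta> K"
  shows "(\<integral>x. (u x - convol K u x)\<^sup>2 \<partial>lborel) \<le> \<eta>\<^sup>2 * grad_energy g"
proof -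
  have u2: "sq_integrable u" using u by (simp add: sobolev_def)
  have [measurable]: "u \<in> borel_measurable borel" using u2 by (simp add: sq_integrable_def)
  have k: "compact_kernel \<eta> K" and K0: "\<And>x. 0 \<le> K x" and K1: "(\<integral>x. K x \<partial>lborel) = 1"
    using K by (auto simp: prob_kernel_def)
  note KI = compact_kernel_integrable[OF k] and [measurable] = compact_kernel_measurable[OF k]
  have "0 \<le> \<eta>"
  proof (rule ccontr)
    assume "\<not> 0 \<le> \<eta>"
    then have "\<eta> < norm x" for x :: "real^2" using norm_ge_zero[of x] by linarith
    then have "K = (\<lambda>x. 0)" using k by (auto simp: compact_kernel_def)
    then show False using K1 by simp
  qed
  define N where "N y = (\<integral>x. (u x - u (x - y))\<^sup>2 \<partial>lborel)" for y
  have N0: "N y \<ge> 0" for y unfolding N_def by (intro integral_nonneg_AE) auto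
  have KN: "K y * N y \<le> \<eta>\<^sup>2 * grad_energy g * K y" for y
  proof (cases "norm y \<le> \<eta>")
    case True
    have "N y \<le> (norm y)\<^sup>2 * grad_energy g" unfolding N_def by (rule sobolev_translate[OF u])
    also have "\<dots> \<le> \<eta>\<^sup>2 * grad_energy g"
      using True by (intro mult_right_mono power_mono grad_energy_nonneg) auto
    finally show ?thesis using K0[of y] by (metis mult.commute mult_right_mono)
  next
    case False
    then show ?thesis using k by (simp add: compact_kernel_def)
  qed
  have [measurable]: "N \<in> borel_measurable borel" unfolding N_def[abs_def] by measurable
  have KNI: "integrable lborel (\<lambda>y. K y * N y)"
  proof (rule Bochner_Integration.integrable_bound)
    show "integrable lborel (\<lambda>y. \<eta>\<^sup>2 * grad_energy g * K y)" using KI by simp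
    have "norm (K y * N y) \<le> norm (\<eta>\<^sup>2 * grad_energy g * K y)" for y
      using KN[of y] K0[of y] N0[of y] grad_energy_nonneg[of g] by (simp add: abs_mult)
    then show "AE y in lborel. norm (K y * N y) \<le> norm (\<eta>\<^sup>2 * grad_energy g * K y)" by simp
  qed measurable
  have tr: "sq_integrable (\<lambda>x. u x - u (x - y))" for y
    using sq_integrable_diff[OF u2 sq_integrable_shift[OF u2, of "- y"]] by simp
  have P: "integrable (lborel \<Otimes>\<^sub>M lborel) (\<lambda>(y, x). (u x - u (x - y))\<^sup>2 * K y)"
  proof (rule lborel_pair.Fubini_integrable)
    show "(\<lambda>(y, x). (u x - u (x - y))\<^sup>2 * K y) \<in> borel_measurable (lborel \<Otimes>\<^sub>M lborel)"
      by measurable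
    show "integrable lborel (\<lambda>y. \<integral>x. norm (case (y, x) of (y, x) \<Rightarrow> (u x - u (x - y))\<^sup>2 * K y) \<partial>lborel)"
      using KNI K0 by (simp add: N_def abs_mult mult.commute)
    show "AE y in lborel. integrable lborel (\<lambda>x. case (y, x) of (y, x) \<Rightarrow> (u x - u (x - y))\<^sup>2 * K y)"
      using tr by (simp add: sq_integrable_def)
  qed
  have pointwise: "(u x - convol K u x)\<^sup>2 \<le> (\<integral>y. (u x - u (x - y))\<^sup>2 * K y \<partial>lborel)" for x
  proof -
    have a: "integrable lborel (\<lambda>y. u (x - y) * K y)" and b: "integrable lborel (\<lambda>y. (u (x - y))\<^sup>2 * K y)"
      using sq_integrable_mult[OF sq_integrable_reflect[OF u2] compact_kernel_sq_integrable[OF k], of x]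
        integrable_mult_compact_kernel[OF k, of "\<lambda>y. (u (x - y))\<^sup>2"] sq_integrable_reflect[OF u2, of x]
      by (auto simp: sq_integrable_def)
    have "(\<lambda>y. (u x - u (x - y))\<^sup>2 * K y)
        = (\<lambda>y. (u x)\<^sup>2 * K y + (u (x - y))\<^sup>2 * K y - 2 * u x * (u (x - y) * K y))"
      by (auto simp: power2_diff algebra_simps)
    then have c: "integrable lborel (\<lambda>y. (u x - u (x - y))\<^sup>2 * K y)"
      using a b KI by simp
    have "convol K u x = (\<integral>y. u (x - y) * K y \<partial>lborel)"
      using integral_reflect[of "\<lambda>y. u (x - y) * K y" x] by (simp add: convol_def)
    then have "u x - convol K u x = (\<integral>y. (u x - u (x - y)) * K y \<partial>lborel)"
      using a KI K1 by (simp add: left_diff_distrib)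
    then show ?thesis
      using sq_integral_mult_prob_le(2)[OF K0 KI K1 _ c] by simp
  qed
  have "(\<integral>x. (u x - convol K u x)\<^sup>2 \<partial>lborel) \<le> (\<integral>x. \<integral>y. (u x - u (x - y))\<^sup>2 * K y \<partial>lborel \<partial>lborel)"
    using sq_integrable_diff[OF u2 sq_integrable_convol[OF K u2]] lborel_pair.integrable_snd[OF P] pointwise
    by (intro integral_mono) (auto simp: sq_integrable_def)
  also have "\<dots> = (\<integral>y. \<integral>x. (u x - u (x - y))\<^sup>2 * K y \<partial>lborel \<partial>lborel)"
    by (rule lborel_pair.Fubini_integral[OF P])
  also have "\<dots> = (\<integral>y. K y * N y \<partial>lborel)"
    by (simp add: N_def mult.commute)
  also have "\<dots> \<le> (\<integral>y. \<eta>\<^sup>2 * grad_energy g * K y \<partial>lborel)"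
    using KN KNI KI by (intro integral_mono) auto
  also have "\<dots> = \<eta>\<^sup>2 * grad_energy g" using K1 by simp
  finally show ?thesis .
qed

lemma mollifier_derivative_odd:
  assumes "mollifier \<eta> K dK"
  shows "dK (- x) = - dK x"
proof -
  have t: "test_fun K dK" and e: "\<And>x. K (- x) = K x" using assms by (auto simp: mollifier_def)
  have "test_fun K (\<lambda>x. - dK (- x))" using test_fun_reflect[OF t, of 0] by (simp add: e)
  with t have "(\<lambda>v. dK x \<bullet> v) = (\<lambda>v. - dK (- x) \<bullet> v)"
    unfolding test_fun_def by (meson has_derivative_unique)
  then have "dK x = - dK (- x)" by (metis vector_eq_rdot)
  then show ?thesis by simp
qed

text \<open>With one factor of each product mollified the identity is exact, by self-adjointness and
  oddness of the kernel gradient. Removing the mollifier costs O(\<eta>), while the defect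
  \<open>I\<close> does not depend on \<eta>.\<close>

lemma sobolev_integration_by_parts:
  assumes a: "sobolev a ga" and b: "sobolev b gb"
  shows "(\<integral>x. a x * gb i x \<partial>lborel) = - (\<integral>x. b x * ga i x \<partial>lborel)"
proof -
  have a2: "sq_integrable a" and ga: "sq_integrable (ga i)" and wa: "weak_partial a i (ga i)"
    using a by (auto simp: sobolev_def)
  have b2: "sq_integrable b" and gb: "sq_integrable (gb i)" and wb: "weak_partial b i (gb i)"
    using b by (auto simp: sobolev_def)
  define I where "I = (\<integral>x. a x * gb i x \<partial>lborel) + (\<integral>x. b x * ga i x \<partial>lborel)"
  define C where "C = (\<integral>x. (gb i x)\<^sup>2 \<partial>lborel) + grad_energy ga + (\<integral>x. (ga i x)\<^sup>2 \<partial>lborel) + grad_energy gb"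
  have bound: "2 * \<bar>I\<bar> \<le> \<eta> * C" if \<eta>: "\<eta> > 0" for \<eta>
  proof -
    obtain K dK where K: "mollifier \<eta> K dK" using mollifier_exists[OF \<eta>] .
    have t: "test_fun K dK" and p: "prob_kernel \<eta> K" and k: "compact_kernel \<eta> K" and e: "\<And>x. K (- x) = K x"
      using K by (auto simp: mollifier_def prob_kernel_def)
    obtain R where R: "\<And>i. compact_kernel R (\<lambda>x. dK x $ i)"
      using test_fun_compact_kernel[OF t] by blast
    have "(\<integral>x. gb i x * convol K a x \<partial>lborel) = (\<integral>x. a x * convol K (gb i) x \<partial>lborel)"
      using integral_mult_convol[OF a2 gb k] by (simp add: e)
    also have "\<dots> = (\<integral>x. a x * convol (\<lambda>x. dK x $ i) b x \<partial>lborel)"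
      by (simp add: convol_weak_partial[OF wb t])
    also have "\<dots> = (\<integral>x. b x * convol (\<lambda>x. dK (- x) $ i) a x \<partial>lborel)"
      by (rule integral_mult_convol[OF a2 b2 R])
    also have "\<dots> = - (\<integral>x. b x * convol (\<lambda>x. dK x $ i) a x \<partial>lborel)"
      by (simp add: mollifier_derivative_odd[OF K] convol_def)
    also have "\<dots> = - (\<integral>x. b x * convol K (ga i) x \<partial>lborel)"
      by (simp add: convol_weak_partial[OF wa t])
    also have "(\<integral>x. b x * convol K (ga i) x \<partial>lborel) = (\<integral>x. ga i x * convol K b x \<partial>lborel)"
      using integral_mult_convol[OF b2 ga k] by (simp add: e)
    finally have eq: "(\<integral>x. gb i x * convol K a x \<partial>lborel) = - (\<integral>x. ga i x * convol K b x \<partial>lborel)" .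
    note Ka = sq_integrable_convol[OF p a2] and Kb = sq_integrable_convol[OF p b2]
    have "(\<integral>x. gb i x * (a x - convol K a x) \<partial>lborel)
        = (\<integral>x. a x * gb i x \<partial>lborel) - (\<integral>x. gb i x * convol K a x \<partial>lborel)"
      using sq_integrable_mult[OF gb a2] sq_integrable_mult[OF gb Ka]
      by (simp add: right_diff_distrib mult.commute)
    moreover have "(\<integral>x. ga i x * (b x - convol K b x) \<partial>lborel)
        = (\<integral>x. b x * ga i x \<partial>lborel) - (\<integral>x. ga i x * convol K b x \<partial>lborel)"
      using sq_integrable_mult[OF ga b2] sq_integrable_mult[OF ga Kb]
      by (simp add: right_diff_distrib mult.commute)
    ultimately have I: "I = (\<integral>x. gb i x * (a x - convol K a x) \<partial>lborel) + (\<integral>x. ga i x * (b x - convol K b x) \<partial>lborel)"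
      using eq by (simp add: I_def)
    \<comment> \<open>Young with weight \<eta>: the squared mollification error is at most \<eta>^2
      times the gradient energy, so division by \<eta> leaves one power of \<eta>.\<close>
    have "2 * \<bar>\<integral>x. gb i x * (a x - convol K a x) \<partial>lborel\<bar> \<le> \<eta> * (\<integral>x. (gb i x)\<^sup>2 \<partial>lborel) + \<eta> * grad_energy ga"
      using integral_mult_le_square[OF gb sq_integrable_diff[OF a2 Ka] \<eta>]
        divide_right_mono[OF sobolev_convol_error[OF a p], of \<eta>] \<eta> by (simp add: power2_eq_square)
    moreover have "2 * \<bar>\<integral>x. ga i x * (b x - convol K b x) \<partial>lborel\<bar> \<le> \<eta> * (\<integral>x. (ga i x)\<^sup>2 \<partial>lborel) + \<eta> * grad_energy gb"
      using integral_mult_le_square[OF ga sq_integrable_diff[OF b2 Kb] \<eta>]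
        divide_right_mono[OF sobolev_convol_error[OF b p], of \<eta>] \<eta> by (simp add: power2_eq_square)
    ultimately show ?thesis
      using abs_triangle_ineq[of "\<integral>x. gb i x * (a x - convol K a x) \<partial>lborel"
          "\<integral>x. ga i x * (b x - convol K b x) \<partial>lborel"]
      unfolding I C_def by (simp add: distrib_left)
  qed
  have "I = 0"
  proof (rule ccontr)
    assume "I \<noteq> 0"
    then have I: "\<bar>I\<bar> > 0" by simp
    have C: "0 < C" using bound[of 1] I by simp
    \<comment> \<open>The scale |I| / C turns the bound into 2 |I| \<le> |I|.\<close>
    have "2 * \<bar>I\<bar> \<le> \<bar>I\<bar>" using bound[of "\<bar>I\<bar> / C"] C I by simp
    then show False using I by simp
  qed
  then show ?thesis by (simp add: I_def)
qed

section \<open>The energy estimate\<close>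

text \<open>The quartic integral deliberately remains on the right under the square root: it will be
  small by assumption and then acts as a small coefficient of \<integral> P.\<close>

lemma sobolev_quartic_bound:
  fixes u :: "'k::finite \<Rightarrow> real^2 \<Rightarrow> real" and K :: "real^2 \<Rightarrow> real"
  defines "P \<equiv> \<lambda>x. \<Sum>k\<in>UNIV. (u k x)\<^sup>2"
  assumes u: "\<And>k. sobolev (u k) (g k)" and P4: "\<And>x. P x \<le> 4"
    and K: "prob_kernel \<eta> K" and B: "\<And>x. K x \<le> B"
  shows "integrable lborel (\<lambda>x. (P x)\<^sup>2)"
    and "(\<integral>x. (P x)\<^sup>2 \<partial>lborel) \<le> 2 * CARD('k) * sqrt (B * (\<integral>x. (P x)\<^sup>2 \<partial>lborel)) * (\<integral>x. P x \<partial>lborel)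
      + 8 * \<eta>\<^sup>2 * (\<Sum>k\<in>UNIV. grad_energy (g k))"
proof -
  have u2: "sq_integrable (u k)" for k using u by (simp add: sobolev_def)
  then have um[measurable]: "u k \<in> borel_measurable borel"
    and uI: "integrable lborel (\<lambda>x. (u k x)\<^sup>2)" for k by (auto simp: sq_integrable_def)
  have P0: "P x \<ge> 0" for x by (simp add: P_def sum_nonneg)
  have uP: "(u k x)\<^sup>2 \<le> P x" for k x
    unfolding P_def by (rule member_le_sum) auto
  have [measurable]: "P \<in> borel_measurable borel" unfolding P_def by measurable
  have PI: "integrable lborel P" unfolding P_def using uI by (intro Bochner_Integration.integrable_sum)
  have PP: "(P x)\<^sup>2 \<le> 4 * P x" for x
    using mult_right_mono[OF P4 P0, of x x] by (simp add: power2_eq_square)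
  show P2: "integrable lborel (\<lambda>x. (P x)\<^sup>2)"
  proof (rule Bochner_Integration.integrable_bound)
    show "integrable lborel (\<lambda>x. 4 * P x)" using PI by simp
    show "AE x in lborel. norm ((P x)\<^sup>2) \<le> norm (4 * P x)" using PP P0 by simp
  qed measurable
  define Q where "Q = (\<integral>x. (P x)\<^sup>2 \<partial>lborel)"
  have u4: "sq_integrable (\<lambda>x. (u k x)\<^sup>2)" for k
    unfolding sq_integrable_def
  proof
    show "integrable lborel (\<lambda>x. ((u k x)\<^sup>2)\<^sup>2)"
    proof (rule Bochner_Integration.integrable_bound[OF P2])
      show "AE x in lborel. norm (((u k x)\<^sup>2)\<^sup>2) \<le> norm ((P x)\<^sup>2)"
        using power_mono[OF uP, of k _ 2] by simp
    qed measurable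
  qed measurable
  have k: "compact_kernel \<eta> K" and K0: "\<And>x. 0 \<le> K x" using K by (auto simp: prob_kernel_def)
  \<comment> \<open>Jensen twice: the fourth power of the mollification is at most the mollification
    of the fourth power, hence at most B Q.\<close>
  have sup: "(convol K (u k) x)\<^sup>2 \<le> sqrt (B * Q)" for k x
  proof (rule real_le_rsqrt)
    have "((convol K (u k) x)\<^sup>2)\<^sup>2 \<le> (convol K (\<lambda>z. (u k z)\<^sup>2) x)\<^sup>2"
      by (intro power_mono convol_square_le[OF K u2]) simp
    also have "\<dots> \<le> convol K (\<lambda>z. ((u k z)\<^sup>2)\<^sup>2) x"
      by (rule convol_square_le[OF K u4])
    also have "\<dots> \<le> (\<integral>z. B * (P z)\<^sup>2 \<partial>lborel)"
      unfolding convol_def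
    proof (rule integral_mono)
      show "integrable lborel (\<lambda>z. ((u k z)\<^sup>2)\<^sup>2 * K (x - z))"
        using u4[of k] by (intro integrable_mult_compact_kernel[OF compact_kernel_translate[OF k]])
          (simp add: sq_integrable_def)
      show "integrable lborel (\<lambda>z. B * (P z)\<^sup>2)" using P2 by simp
      fix z
      have "((u k z)\<^sup>2)\<^sup>2 * K (x - z) \<le> (P z)\<^sup>2 * B"
        using uP[of k z] B K0 by (intro mult_mono power_mono) auto
      then show "((u k z)\<^sup>2)\<^sup>2 * K (x - z) \<le> B * (P z)\<^sup>2" by (simp add: mult.commute)
    qed
    also have "\<dots> = B * Q" by (simp add: Q_def)
    finally show "((convol K (u k) x)\<^sup>2)\<^sup>2 \<le> B * Q" .
  qed
  define W where "W x = (\<Sum>k\<in>UNIV. (u k x - convol K (u k) x)\<^sup>2)" for x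
  have wI: "integrable lborel (\<lambda>x. (u k x - convol K (u k) x)\<^sup>2)" for k
    using sq_integrable_diff[OF u2 sq_integrable_convol[OF K u2]] by (simp add: sq_integrable_def)
  have W0: "W x \<ge> 0" for x by (simp add: W_def sum_nonneg)
  define c where "c = 2 * CARD('k) * sqrt (B * Q)"
  have split: "P x \<le> 2 * W x + c" for x
  proof -
    have "P x \<le> (\<Sum>k\<in>UNIV. 2 * (u k x - convol K (u k) x)\<^sup>2 + 2 * sqrt (B * Q))"
      unfolding P_def
    proof (rule sum_mono)
      fix k
      have "(u k x)\<^sup>2 \<le> 2 * (u k x - convol K (u k) x)\<^sup>2 + 2 * (convol K (u k) x)\<^sup>2"
        \<comment> \<open>The gap between the two sides is exactly (u - 2 v)^2, where v is the
          mollification of u.\<close>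
        using zero_le_power2[of "u k x - 2 * convol K (u k) x"] by (simp add: power2_eq_square algebra_simps)
      then show "(u k x)\<^sup>2 \<le> 2 * (u k x - convol K (u k) x)\<^sup>2 + 2 * sqrt (B * Q)"
        using sup[of k x] by linarith
    qed
    also have "\<dots> = 2 * W x + c"
      by (simp add: W_def c_def sum.distrib sum_distrib_left)
    finally show ?thesis .
  qed
  have "Q \<le> (\<integral>x. c * P x + 8 * W x \<partial>lborel)"
    unfolding Q_def
  proof (rule integral_mono[OF P2])
    show "integrable lborel (\<lambda>x. c * P x + 8 * W x)"
      unfolding W_def using PI wI by simp
    fix x
    \<comment> \<open>Only one factor P is split; the other is bounded by 4 next to W and kept next
      to c.\<close>
    have "(P x)\<^sup>2 \<le> P x * (2 * W x + c)"
      unfolding power2_eq_square by (rule mult_left_mono[OF split P0])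
    moreover have "P x * (2 * W x) \<le> 4 * (2 * W x)"
      using W0[of x] by (intro mult_right_mono P4) simp
    ultimately show "(P x)\<^sup>2 \<le> c * P x + 8 * W x" by (simp add: algebra_simps)
  qed
  also have "\<dots> = c * (\<integral>x. P x \<partial>lborel) + 8 * (\<Sum>k\<in>UNIV. \<integral>x. (u k x - convol K (u k) x)\<^sup>2 \<partial>lborel)"
    unfolding W_def using PI wI by (simp add: Bochner_Integration.integral_sum)
  also have "\<dots> \<le> c * (\<integral>x. P x \<partial>lborel) + 8 * (\<Sum>k\<in>UNIV. \<eta>\<^sup>2 * grad_energy (g k))"
    by (intro add_left_mono mult_left_mono sum_mono sobolev_convol_error[OF u K]) simp
  finally show "(\<integral>x. (P x)\<^sup>2 \<partial>lborel) \<le> 2 * CARD('k) * sqrt (B * (\<integral>x. (P x)\<^sup>2 \<partial>lborel)) * (\<integral>x. P x \<partial>lborel)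
      + 8 * \<eta>\<^sup>2 * (\<Sum>k\<in>UNIV. grad_energy (g k))"
    by (simp add: Q_def c_def sum_distrib_left mult.assoc)
qed

section \<open>From maps in \<open>Mprime\<close> to their scalar components\<close>

lemma e3_nth [simp]: "e3 $ 1 = 0" "e3 $ 2 = 0" "e3 $ 3 = 1"
  by (simp_all add: e3_def axis_def)

lemma norm_vec_square: "(norm (v :: real^'k))\<^sup>2 = (\<Sum>k\<in>UNIV. (v $ k)\<^sup>2)"
  unfolding power2_norm_eq_inner by (simp add: inner_vec_def power2_eq_square)

text \<open>On the unit sphere |n - e3|^2 = 2 (1 - n3), so finiteness of Z is square integrability
  of n - e3. Each gradient component is dominated by the finite Dirichlet density.\<close>

lemma Mprime_sobolev:
  assumes n: "n \<in> Mprime"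
  shows "sobolev (\<lambda>x. (n x - e3) $ k) (\<lambda>i x. wgrad n i x $ k)"
    and "integrable lborel (\<lambda>x. 1 - n x $ 3)"
proof -
  have nm[measurable]: "n \<in> borel_measurable borel" and n1: "\<And>x. norm (n x) = 1"
    and ex: "\<exists>G. weak_gradient n G"
    and finG: "(\<integral>\<^sup>+x. ennreal (\<Sum>i\<in>UNIV. (norm (wgrad n i x))\<^sup>2) \<partial>lborel) < \<infinity>"
    and finZ: "(\<integral>\<^sup>+x. ennreal (1 - n x $ 3) \<partial>lborel) < \<infinity>"
    using n by (auto simp: Mprime_def)
  have comp[measurable]: "(\<lambda>x. n x $ k) \<in> borel_measurable borel" for k
    using measurable_compose[OF nm, of "\<lambda>v. v $ k" borel]
    by (auto intro!: borel_measurable_continuous_onI continuous_intros)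
  have n3: "1 - n x $ 3 \<ge> 0" for x
    using component_le_norm_cart[of "n x" 3] n1[of x] by simp
  show Z: "integrable lborel (\<lambda>x. 1 - n x $ 3)"
  proof (rule integrableI_nonneg)
    show "AE x in lborel. 0 \<le> 1 - n x $ 3" using n3 by simp
  qed (use finZ in simp_all)
  have "weak_gradient n (wgrad n)"
    unfolding wgrad_def by (rule someI_ex[OF ex])
  then have wp: "weak_partial (\<lambda>x. n x $ k) i (\<lambda>x. wgrad n i x $ k)" for k i
    by (simp add: weak_gradient_def)
  note gm[measurable] = weak_partial_measurable[OF wp]
  have sq: "((n x - e3) $ k)\<^sup>2 \<le> 2 * (1 - n x $ 3)" for x k
  proof -
    have "((n x - e3) $ k)\<^sup>2 \<le> (norm (n x - e3))\<^sup>2"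
      unfolding norm_vec_square by (rule member_le_sum) auto
    also have "\<dots> = 2 * (1 - n x $ 3)"
      using n1[of x] norm_vec_square[of "n x"]
      by (simp add: norm_vec_square sum_3 power2_diff)
    finally show ?thesis .
  qed
  have "sq_integrable (\<lambda>x. (n x - e3) $ k)" for k
    unfolding sq_integrable_def
  proof
    show "integrable lborel (\<lambda>x. ((n x - e3) $ k)\<^sup>2)"
    proof (rule Bochner_Integration.integrable_bound)
      show "integrable lborel (\<lambda>x. 2 * (1 - n x $ 3))" by (rule integrable_mult_right[OF Z])
      show "AE x in lborel. norm (((n x - e3) $ k)\<^sup>2) \<le> norm (2 * (1 - n x $ 3))"
        using sq n3 by (simp add: abs_of_nonneg)
    qed simp
  qed simp
  moreover have "weak_partial (\<lambda>x. (n x - e3) $ k) i (\<lambda>x. wgrad n i x $ k)" for i k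
    using weak_partial_add_const[OF wp[of k i], of "- e3 $ k"] by simp
  moreover have "sq_integrable (\<lambda>x. wgrad n i x $ k)" for i k
    unfolding sq_integrable_def
  proof
    have S: "integrable lborel (\<lambda>x. \<Sum>i\<in>UNIV. (norm (wgrad n i x))\<^sup>2)"
    proof (rule integrableI_nonneg)
      show "(\<lambda>x. \<Sum>i\<in>UNIV. (norm (wgrad n i x))\<^sup>2) \<in> borel_measurable lborel"
        unfolding norm_vec_square by measurable
    qed (use finG in \<open>simp_all add: sum_nonneg\<close>)
    have le: "(wgrad n i x $ k)\<^sup>2 \<le> (\<Sum>i\<in>UNIV. (norm (wgrad n i x))\<^sup>2)" for x
    proof -
      have "(wgrad n i x $ k)\<^sup>2 \<le> (norm (wgrad n i x))\<^sup>2"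
        unfolding norm_vec_square by (rule member_le_sum) auto
      also have "\<dots> \<le> (\<Sum>i\<in>UNIV. (norm (wgrad n i x))\<^sup>2)" by (rule member_le_sum) auto
      finally show ?thesis .
    qed
    show "integrable lborel (\<lambda>x. (wgrad n i x $ k)\<^sup>2)"
    proof (rule Bochner_Integration.integrable_bound[OF S])
      show "AE x in lborel. norm ((wgrad n i x $ k)\<^sup>2) \<le> norm (\<Sum>i\<in>UNIV. (norm (wgrad n i x))\<^sup>2)"
        using le by (simp add: abs_of_nonneg sum_nonneg)
    qed simp
  qed simp
  ultimately show "sobolev (\<lambda>x. (n x - e3) $ k) (\<lambda>i x. wgrad n i x $ k)"
    by (simp add: sobolev_def)
qed

lemma sum_grad_energy:
  assumes "\<And>i k. sq_integrable (\<lambda>x. G i x $ k)"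
  shows "(\<integral>x. (\<Sum>i\<in>UNIV. (norm (G i x :: real^'k))\<^sup>2) \<partial>lborel) = (\<Sum>k\<in>UNIV. grad_energy (\<lambda>i x. G i x $ k))"
proof -
  have I: "integrable lborel (\<lambda>x. (G i x $ k)\<^sup>2)" for i k
    using assms by (simp add: sq_integrable_def)
  have "(\<integral>x. (\<Sum>i\<in>UNIV. (norm (G i x))\<^sup>2) \<partial>lborel) = (\<Sum>i\<in>UNIV. \<Sum>k\<in>UNIV. \<integral>x. (G i x $ k)\<^sup>2 \<partial>lborel)"
    unfolding norm_vec_square using I by (simp add: Bochner_Integration.integral_sum)
  then show ?thesis
    unfolding grad_energy_def by (subst sum.swap) simp
qed

text \<open>The factor n - e3 kills the helicity, but the Dirichlet term needs an argument:
  \<open>wgrad\<close> is a choice among weak gradients, so for a constant map it is not literally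
  0.\<close>

lemma Energy_e3: "Energy r h (\<lambda>_. e3) = 0"
proof -
  let ?G = "wgrad (\<lambda>_. e3)"
  have "weak_gradient (\<lambda>_. e3) (\<lambda>_ _. 0)"
    by (simp add: weak_gradient_def weak_partial_const)
  then have "weak_gradient (\<lambda>_. e3) ?G"
    unfolding wgrad_def by (rule someI[of "weak_gradient (\<lambda>_. e3)"])
  then have wp: "weak_partial (\<lambda>x. e3 $ k) i (\<lambda>x. ?G i x $ k)" for k i
    by (simp add: weak_gradient_def)
  note [measurable] = weak_partial_measurable[OF wp]
  \<comment> \<open>If the sum is not integrable, its Bochner integral is 0 by convention.\<close>
  have "(\<integral>x. (\<Sum>i\<in>UNIV. (norm (?G i x))\<^sup>2) \<partial>lborel) = 0"
  proof (cases "integrable lborel (\<lambda>x. \<Sum>i\<in>UNIV. (norm (?G i x))\<^sup>2)")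
    case True
    have le: "(?G i x $ k)\<^sup>2 \<le> (\<Sum>i\<in>UNIV. (norm (?G i x))\<^sup>2)" for i k x
    proof -
      have "(?G i x $ k)\<^sup>2 \<le> (norm (?G i x))\<^sup>2"
        unfolding norm_vec_square by (rule member_le_sum) auto
      also have "\<dots> \<le> (\<Sum>i\<in>UNIV. (norm (?G i x))\<^sup>2)" by (rule member_le_sum) auto
      finally show ?thesis .
    qed
    have sq: "sq_integrable (\<lambda>x. ?G i x $ k)" for i k
      unfolding sq_integrable_def
    proof
      show "integrable lborel (\<lambda>x. (?G i x $ k)\<^sup>2)"
      proof (rule Bochner_Integration.integrable_bound[OF True])
        show "AE x in lborel. norm ((?G i x $ k)\<^sup>2) \<le> norm (\<Sum>i\<in>UNIV. (norm (?G i x))\<^sup>2)"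
          using le by (simp add: abs_of_nonneg sum_nonneg)
      qed simp
    qed simp
    show ?thesis
      using sum_grad_energy[of ?G, OF sq] weak_partial_const_unique[OF wp sq] by (simp add: grad_energy_def)
  qed (rule not_integrable_integral_eq)
  then show ?thesis
    by (simp add: Energy_def Dir_def Hel_def Pot_def Zee_def)
qed

text \<open>The gradient energy \<open>\<Gamma>\<close> is spent completely: the Dirichlet term
  provides \<Gamma> / 2, the helicity takes one quarter of \<Gamma> and the quartic bound on 2 r^2 Q
  the other. The second claim makes Z positive whenever Q is.\<close>

lemma Energy_lower_bound:
  fixes K :: "real^2 \<Rightarrow> real"
  assumes n: "n \<in> Mprime" and r: "r > 0" and K: "prob_kernel (1 / (8 * r)) K" and B: "\<And>x. K x \<le> B"
  defines "Q \<equiv> \<integral>x. norm (n x - e3) ^ 4 \<partial>lborel"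
  shows "Energy r h n \<ge> (h - 24 * r\<^sup>2 * sqrt (B * Q)) * Zee n" and "Q \<le> 8 * Zee n"
proof -
  define u where "u k x = (n x - e3) $ k" for k x
  define g where "g k i x = wgrad n i x $ k" for k i x
  have s: "sobolev (u k) (g k)" for k
    using Mprime_sobolev(1)[OF n] by (simp add: u_def[abs_def] g_def[abs_def])
  have u2: "sq_integrable (u k)" and g2: "sq_integrable (g k i)" for k i
    using s by (auto simp: sobolev_def)
  have n1: "norm (n x) = 1" for x using n by (simp add: Mprime_def)
  define P where "P x = (\<Sum>k\<in>UNIV. (u k x)\<^sup>2)" for x
  have P: "P x = (norm (n x - e3))\<^sup>2" for x by (simp add: P_def u_def norm_vec_square)
  have Pn: "P x = 2 * (1 - n x $ 3)" for x
    using n1[of x] norm_vec_square[of "n x"] by (simp add: P_def u_def sum_3 power2_diff)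
  have u3: "u 3 x = - P x / 2" for x by (simp add: Pn u_def)
  have P0: "P x \<ge> 0" for x by (simp add: P)
  have P4: "P x \<le> 4" for x
    using component_le_norm_cart[of "n x" 3] n1[of x] by (simp add: Pn)
  have Q: "Q = (\<integral>x. (P x)\<^sup>2 \<partial>lborel)"
    by (simp add: Q_def P power_mult[symmetric])
  have Z: "(\<integral>x. P x \<partial>lborel) = 2 * Zee n" unfolding Pn Zee_def by (rule integral_mult_right_zero)
  have PI: "integrable lborel P" unfolding Pn[abs_def] by (rule integrable_mult_right[OF Mprime_sobolev(2)[OF n]])
  define \<Gamma> where "\<Gamma> = (\<Sum>k\<in>UNIV. grad_energy (g k))"
  note quartic = sobolev_quartic_bound[of u g, OF s P4[unfolded P_def] K B, folded P_def]
  have P2: "integrable lborel (\<lambda>x. (P x)\<^sup>2)" by (rule quartic(1))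
  \<comment> \<open>The 6 is twice the number of components; \<integral> P = 2 Z.\<close>
  have "Q \<le> 6 * sqrt (B * Q) * (2 * Zee n) + 8 * (1 / (8 * r))\<^sup>2 * \<Gamma>"
    using quartic(2) by (simp add: Q Z \<Gamma>_def)
  then have "2 * r\<^sup>2 * Q \<le> 2 * r\<^sup>2 * (6 * sqrt (B * Q) * (2 * Zee n) + 8 * (1 / (8 * r))\<^sup>2 * \<Gamma>)"
    by (rule mult_left_mono) simp
  also have "\<dots> = 24 * r\<^sup>2 * sqrt (B * Q) * Zee n + (2 * r\<^sup>2 * (8 * (1 / (8 * r))\<^sup>2)) * \<Gamma>"
    by (simp add: algebra_simps)
  also have "2 * r\<^sup>2 * (8 * (1 / (8 * r))\<^sup>2) = 1 / 4"
    using r by (simp add: power2_eq_square)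
  finally have Qr: "2 * r\<^sup>2 * Q \<le> 24 * r\<^sup>2 * sqrt (B * Q) * Zee n + \<Gamma> / 4"
    by simp
  have "Q \<le> (\<integral>x. 4 * P x \<partial>lborel)"
    unfolding Q
  proof (rule integral_mono[OF P2])
    show "(P x)\<^sup>2 \<le> 4 * P x" for x
      using mult_right_mono[OF P4 P0, of x x] by (simp add: power2_eq_square)
  qed (use PI in simp)
  then show "Q \<le> 8 * Zee n" by (simp add: Z)
  have Q0: "Q \<ge> 0" unfolding Q by (intro integral_nonneg_AE) simp
  have D: "Dir n = \<Gamma> / 2"
    using sum_grad_energy[of "wgrad n", OF g2[unfolded g_def]] by (simp add: Dir_def \<Gamma>_def g_def[abs_def])
  have "(\<lambda>x. (n x - e3) \<bullet> curl n x)
      = (\<lambda>x. u 1 x * g 3 2 x - u 2 x * g 3 1 x + (u 3 x * g 2 1 x - u 3 x * g 1 2 x))"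
    by (auto simp: curl_def u_def g_def inner_vec_def sum_3 vector_3 algebra_simps)
  moreover note ug = sq_integrable_mult[OF u2 g2]
  ultimately have "Hel n = (\<integral>x. u 1 x * g 3 2 x \<partial>lborel) - (\<integral>x. u 2 x * g 3 1 x \<partial>lborel)
      + ((\<integral>x. u 3 x * g 2 1 x \<partial>lborel) - (\<integral>x. u 3 x * g 1 2 x \<partial>lborel))"
    by (simp add: Hel_def)
  \<comment> \<open>Moving the derivatives off \<open>u 3\<close> doubles the other two terms. Every
    term then carries \<open>u 3\<close>, which is quadratic in u, so its square integrates to Q /
    4.\<close>
  also have "(\<integral>x. u 1 x * g 3 2 x \<partial>lborel) = - (\<integral>x. u 3 x * g 1 2 x \<partial>lborel)"
    by (rule sobolev_integration_by_parts[OF s s])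
  also have "(\<integral>x. u 2 x * g 3 1 x \<partial>lborel) = - (\<integral>x. u 3 x * g 2 1 x \<partial>lborel)"
    by (rule sobolev_integration_by_parts[OF s s])
  finally have H: "Hel n = 2 * (\<integral>x. u 3 x * g 2 1 x \<partial>lborel) - 2 * (\<integral>x. u 3 x * g 1 2 x \<partial>lborel)"
    by simp
  have u3Q: "(\<integral>x. (u 3 x)\<^sup>2 \<partial>lborel) = Q / 4"
    by (simp add: u3 Q power_divide)
  have est: "r * (2 * \<bar>\<integral>x. u 3 x * g k i x \<partial>lborel\<bar>) \<le> r\<^sup>2 * Q + (\<integral>x. (g k i x)\<^sup>2 \<partial>lborel) / 4" for k i
  proof -
    \<comment> \<open>The weight 4 r makes the gradient term exactly one quarter after
      multiplication by r.\<close>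
    have "2 * \<bar>\<integral>x. u 3 x * g k i x \<partial>lborel\<bar> \<le> 4 * r * (Q / 4) + (\<integral>x. (g k i x)\<^sup>2 \<partial>lborel) / (4 * r)"
      using integral_mult_le_square[OF u2[of 3] g2[of k i], of "4 * r"] r by (simp add: u3Q)
    from mult_left_mono[OF this, of r] show ?thesis
      using r by (simp add: distrib_left power2_eq_square)
  qed
  have "(\<integral>x. (g 2 1 x)\<^sup>2 \<partial>lborel) \<le> grad_energy (g 2)" "(\<integral>x. (g 1 2 x)\<^sup>2 \<partial>lborel) \<le> grad_energy (g 1)"
    unfolding grad_energy_def by (intro member_le_sum; force intro: integral_nonneg_AE)+
  moreover have "\<Gamma> = grad_energy (g 1) + grad_energy (g 2) + grad_energy (g 3)"
    by (simp add: \<Gamma>_def sum_3)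
  ultimately have G: "(\<integral>x. (g 2 1 x)\<^sup>2 \<partial>lborel) + (\<integral>x. (g 1 2 x)\<^sup>2 \<partial>lborel) \<le> \<Gamma>"
    using grad_energy_nonneg[of "g 3"] by linarith
  have combine: "- 2 * c - G / 4 \<le> r * (2 * a - 2 * b)"
    if "r * (2 * \<bar>a\<bar>) \<le> c + x / 4" "r * (2 * \<bar>b\<bar>) \<le> c + y / 4" "x + y \<le> G"
    for a b c x y G :: real
  proof -
    have "r * (- (2 * \<bar>a\<bar>) - 2 * \<bar>b\<bar>) \<le> r * (2 * a - 2 * b)"
      using r by (intro mult_left_mono) linarith+
    with that show ?thesis unfolding right_diff_distrib mult_minus_right by linarith
  qed
  have "r * Hel n \<ge> - 2 * (r\<^sup>2 * Q) - \<Gamma> / 4"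
    unfolding H by (rule combine[OF est est G])
  moreover have "Pot n = Q / 8" by (simp add: Pot_def Q_def)
  ultimately have "Energy r h n \<ge> h * Zee n - 24 * r\<^sup>2 * sqrt (B * Q) * Zee n"
    using D Qr Q0 unfolding Energy_def by linarith
  then show "Energy r h n \<ge> (h - 24 * r\<^sup>2 * sqrt (B * Q)) * Zee n"
    by (simp add: left_diff_distrib)
qed

theorem theorem5p1:
  fixes r h :: real
  assumes "r > 0" and "h > 0"
  shows "\<exists>\<delta>>0. \<forall>n\<in>Mprime. 0 < L4_dist_e3 n \<and> L4_dist_e3 n \<le> \<delta> \<longrightarrow>
            Energy r h n > Energy r h (\<lambda>_. e3)"
proof -
  have "1 / (8 * r) > 0" using assms by simp
  then obtain K dK where "mollifier (1 / (8 * r)) K dK" by (rule mollifier_exists)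
  then have K: "prob_kernel (1 / (8 * r)) K" by (simp add: mollifier_def)
  then obtain B where B0: "B > 0" and "\<And>x. \<bar>K x\<bar> \<le> B"
    using compact_kernel_bounded unfolding prob_kernel_def by blast
  then have B: "\<And>x. K x \<le> B" by (meson abs_ge_self order_trans)
  \<comment> \<open>Chosen so that 24 r^2 sqrt B \<delta>^2 = h / 2. Since the L^4 norm is the
    fourth root of Q, the bound by \<delta> gives sqrt Q \<le> \<delta>^2.\<close>
  define \<delta> where "\<delta> = sqrt (h / (48 * r\<^sup>2 * sqrt B))"
  have d0: "\<delta> > 0" using assms B0 by (simp add: \<delta>_def)
  show ?thesis
  proof (intro exI[of _ \<delta>] conjI ballI impI d0)
    fix n assume n: "n \<in> Mprime" and L: "0 < L4_dist_e3 n \<and> L4_dist_e3 n \<le> \<delta>"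
    define Q where "Q = (\<integral>x. norm (n x - e3) ^ 4 \<partial>lborel)"
    have L4: "L4_dist_e3 n = Q powr (1/4)" by (simp add: L4_dist_e3_def Q_def)
    have "Q \<ge> 0" unfolding Q_def by (intro integral_nonneg_AE) simp
    \<comment> \<open>If Q were 0, the L^4 distance would be \<open>0 powr (1/4)\<close>, which is
      0.\<close>
    moreover have "Q \<noteq> 0" using L by (auto simp: L4)
    ultimately have Q: "Q > 0" by simp
    have "sqrt Q = (Q powr (1/4))\<^sup>2"
      using Q by (simp add: powr_half_sqrt[symmetric] powr_power)
    also have "\<dots> \<le> \<delta>\<^sup>2" using L by (intro power_mono) (auto simp: L4)
    also have "\<dots> = h / (48 * r\<^sup>2 * sqrt B)" using assms B0 by (simp add: \<delta>_def)
    finally have "sqrt (B * Q) \<le> sqrt B * (h / (48 * r\<^sup>2 * sqrt B))"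
      unfolding real_sqrt_mult using B0 by (intro mult_left_mono) auto
    also have "\<dots> = h / (48 * r\<^sup>2)" using B0 by simp
    finally have "24 * r\<^sup>2 * sqrt (B * Q) \<le> 24 * r\<^sup>2 * (h / (48 * r\<^sup>2))"
      by (intro mult_left_mono) auto
    also have "\<dots> = h / 2" using assms by simp
    finally have "h - 24 * r\<^sup>2 * sqrt (B * Q) > 0" using assms by linarith
    moreover have "Zee n > 0"
      using Energy_lower_bound(2)[OF n assms(1) K B] Q by (simp add: Q_def)
    ultimately have "(h - 24 * r\<^sup>2 * sqrt (B * Q)) * Zee n > 0" by simp
    with Energy_lower_bound(1)[OF n assms(1) K B, of h]
    show "Energy r h n > Energy r h (\<lambda>_. e3)" by (simp add: Energy_e3 Q_def)
  qed
qed

end
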